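(* Assume the Gaussian limit-layer hypotheses stated in the context for the $N\times N$ trained limit layer $W_2^*(N)=S_2^*(N)+R_2^*(N)$. Let $\sigma_1^*(N)\ge\sigma_2^*(N)\ge\cdots$ be the singular values of $S_2^*(N)$ and assume the structured component is spectrally admissible: there is a sequence $k_N=o(N)$ with $\sum_{i>k_N}\sigma_i^*(N)^2\to0$ (in probability when $S_2^*(N)$ is random). Let $s_1(W_2^*(N))\ge s_2(W_2^*(N))\ge\cdots$ be the singular values of the full layer. Then, as $N\to\infty$: (a) $\|R_2^*(N)\|_{\mathrm{op}}\to0$ in probability; (b) for each fixed $i$, $|s_i(W_2^*(N))-\sigma_i^*(N)|\to0$ in probability; (c) $\sum_{i>k_N}s_i(W_2^*(N))^2\to0$ in probability; (d) for every fixed $\epsilon>0$, the singular-value empirical distribution of $W_2^*(N)$ has asymptotically no mass above $\epsilon$, i.e. $\frac1N\#\{i:s_i(W_2^*(N))>\epsilon\}\to0$ in probability; (e) if $\sigma_i^*(N)\to\bar\sigma_i$ (in probability when random) for a fixed $i$, then $s_i(W_2^*(N))\to\bar\sigma_i$ in probability.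
   Context: Setting. For each $N$ there is a classifier network $\phi(\cdot,\alpha)=\rho\circ X(\cdot,\alpha)$ with $K$ classes and weight matrices $W_i$; $\rho(v)_i=e^{v_i}/\sum_{j=1}^K e^{v_j}$, $X(s,\alpha)\in\mathbb R^K$ are the logits. $T$ is a finite nonempty training set, fixed independently of $N$, with correct classes $C(s)\in\{1,\dots,K\}$. For $\lambda_{\mathrm{reg}}>0$ the loss is $$L(\alpha)=-\frac1{|T|}\sum_{s\in T}\log\big(\phi_{C(s)}(s,\alpha)\big)+\lambda_{\mathrm{reg}}\sum_i\|W_i\|_F^2 .$$ Gaussian limit-layer hypotheses. (i) For each $N$ the random training path $\alpha(t,N)$ converges in probability as $t\to\infty$ to $\alpha^*(N)$, whose distinguished $N\times N$ layer matrix is $W_2^*(N)=S_2^*(N)+R_2^*(N)$. At $\alpha^*(N)$, $\phi=\rho\circ\psi_2\circ(R_2^*(N)+S_2^*(N))\circ\psi_1$, where $\psi_1$ (values in $\mathbb R^N$) and $\psi_2:\mathbb R^N\to\mathbb R^K$ may depend on $N$ and on the remaining parameters. (ii) Conditionally on $(S_2^*(N),\psi_1,\psi_2)$ the entries of $R_2^*(N)$ are iid $N(0,g_*(N)/N)$, with $g_*(N)\ge0$ deterministic. (iii) For each $s\in T$ there is a set $\mathcal U_s\supseteq\{(S_2^*(N)+\vartheta R_2^*(N))\psi_1(s):\vartheta\in[0,1]\}$ with $$L_{\psi_2}(s):=\sup_{v,w\in\mathcal U_s,\,v\ne w}\frac{\|\psi_2(v)-\psi_2(w)\|_\infty}{\|v-w\|_\infty}<\infty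 .$$ (iv) There are nonnegative $d_1(N),d_2(N)\to0$ and a nonnegative function $J(v)$ of $v$ only such that for every $v$ measurable with respect to $\sigma(S_2^*(N),\psi_1,\psi_2)$, $\mathbb P(\|R_2^*(N)v\|_\infty>d_1(N)J(v)\mid S_2^*(N),\psi_1,\psi_2)\le d_2(N)$. (v) With $a_\phi(N,s):=J(\psi_1(s))L_{\psi_2}(s)d_1(N)$, for all $s\in T$ one has $a_\phi(N,s)\to0$ as $N\to\infty$ (in probability if random). (vi) $\langle S_2^*(N),R_2^*(N)\rangle_F\to0$ in probability as $N\to\infty$. (vii) Let $\alpha^*_\vartheta(N)$ denote $\alpha^*(N)$ with $W_2^*(N)$ replaced by $S_2^*(N)+\vartheta R_2^*(N)$. There are nonnegative random variables $\epsilon_N\to0$ in probability such that the event $\liminf_{h\downarrow0}h^{-1}\big(L(\alpha^*_{1-h}(N))-L(\alpha^*(N))\big)\ge-\epsilon_N$ has probability tending to one. The singular-value empirical distribution of an $N\times N$ matrix $G$ is $\frac1N\sum_{i=1}^N\delta_{s_i(G)}$ (singular values with multiplicity, including zeros). $\|\cdot\|_{\mathrm{op}}$ is the spectral norm; $\|\cdot\|_F$, $\langle\cdot,\cdot\rangle_F$ are the Frobenius norm and inner product; $\|\cdot\|_\infty$ of a vector is the maximum norm. *)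

theory Defs
  imports
    "HOL-Probability.Probability"
    "HOL-Library.Landau_Symbols"
    "Jordan_Normal_Form.Char_Poly"
begin

text \<open>
  Vectors and matrices are those of \<^theory>\<open>Jordan_Normal_Form.Matrix\<close>, because the layer size
  \<open>N\<close> is a variable. Vector and matrix entries and the \<open>K\<close> classes are indexed from 0, singular
  values from 1.
\<close>

unbundle no vec_syntax
hide_type (open) Finite_Cartesian_Product.vec
hide_const (open) Finite_Cartesian_Product.vec

definition max_norm :: "real vec \<Rightarrow> real" where
  \<comment> \<open>the 0 only matters for vectors of dimension 0\<close>
  "max_norm v = Max (insert 0 ((\<lambda>i. \<bar>v $ i\<bar>) ` {..<dim_vec v}))"

definition frob_inner :: "real mat \<Rightarrow> real mat \<Rightarrow> real" where
  "frob_inner A B = (\<Sum>i<dim_row A. \<Sum>j<dim_col A. A $$ (i, j) * B $$ (i, j))"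

definition frob_norm :: "real mat \<Rightarrow> real" where
  "frob_norm A = sqrt (frob_inner A A)"

definition euclid_norm :: "real vec \<Rightarrow> real" where
  "euclid_norm v = sqrt (\<Sum>i<dim_vec v. (v $ i)\<^sup>2)"

definition op_norm :: "real mat \<Rightarrow> real" where
  "op_norm A = (SUP v\<in>{v \<in> carrier_vec (dim_col A). euclid_norm v \<le> 1}. euclid_norm (A *\<^sub>v v))"

definition singular_values :: "real mat \<Rightarrow> real list" where
  \<comment> \<open>square roots of the eigenvalues of \<open>A\<^sup>T A\<close> with multiplicity, in nonincreasing order\<close>
  "singular_values A =
     rev (sorted_list_of_multiset (image_mset sqrt (proots (char_poly (transpose_mat A * A)))))"

definition sing_val :: "real mat \<Rightarrow> nat \<Rightarrow> real" where
  \<comment> \<open>\<open>s\<^sub>i(A)\<close> for \<open>i \<ge> 1\<close>; set to 0 beyond the size of the matrix\<close>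
  "sing_val A i =
     (if i \<in> {1..length (singular_values A)} then singular_values A ! (i - 1) else 0)"

definition sv_empirical :: "real mat \<Rightarrow> real measure" where
  "sv_empirical A = distr (uniform_count_measure {1..dim_col A}) borel (sing_val A)"

definition conv_prob ::
  "('i \<Rightarrow> 'a measure) \<Rightarrow> ('i \<Rightarrow> 'a \<Rightarrow> real) \<Rightarrow> real \<Rightarrow> 'i filter \<Rightarrow> bool" where
  \<comment> \<open>convergence in probability to a constant along a filter; the probability space may vary\<close>
  "conv_prob M Y c F \<longleftrightarrow>
     (\<forall>\<^sub>F i in F. Y i \<in> borel_measurable (M i)) \<and>
     (\<forall>\<epsilon>>0. ((\<lambda>i. measure (M i) {\<omega> \<in> space (M i). \<bar>Y i \<omega> - c\<bar> > \<epsilon>}) \<longlongrightarrow> 0) F)"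

definition random_vec :: "'a measure \<Rightarrow> nat \<Rightarrow> ('a \<Rightarrow> real vec) \<Rightarrow> bool" where
  "random_vec M n v \<longleftrightarrow>
     v \<in> space M \<rightarrow> carrier_vec n \<and> (\<forall>i<n. (\<lambda>\<omega>. v \<omega> $ i) \<in> borel_measurable M)"

definition random_mat :: "'a measure \<Rightarrow> nat \<Rightarrow> nat \<Rightarrow> ('a \<Rightarrow> real mat) \<Rightarrow> bool" where
  "random_mat M m n A \<longleftrightarrow>
     A \<in> space M \<rightarrow> carrier_mat m n \<and>
     (\<forall>i<m. \<forall>j<n. (\<lambda>\<omega>. A \<omega> $$ (i, j)) \<in> borel_measurable M)"

definition cond_prob_sigma :: "'a measure \<Rightarrow> 'a measure \<Rightarrow> 'a set \<Rightarrow> 'a \<Rightarrow> real" where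
  "cond_prob_sigma M F A = real_cond_exp M F (indicator A)"

definition gaussian :: "real \<Rightarrow> real measure" where
  \<comment> \<open>centred normal law with variance \<open>v \<ge> 0\<close>; the point mass at 0 if \<open>v = 0\<close>\<close>
  "gaussian v =
     (if v = 0 then return borel 0 else density lborel (\<lambda>x. ennreal (normal_density 0 (sqrt v) x)))"

definition cond_iid_entries ::
  "'a measure \<Rightarrow> 'a measure \<Rightarrow> nat \<Rightarrow> ('a \<Rightarrow> real mat) \<Rightarrow> real measure \<Rightarrow> bool" where
  \<comment> \<open>conditionally on \<open>F\<close>, the entries of the random \<open>n \<times> n\<close> matrix are iid with law \<open>\<mu>\<close>\<close>
  "cond_iid_entries M F n R \<mu> \<longleftrightarrow>
     (\<forall>B \<in> {..<n} \<times> {..<n} \<rightarrow> sets borel. AE \<omega> in M.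
        cond_prob_sigma M F {\<omega> \<in> space M. \<forall>i<n. \<forall>j<n. R \<omega> $$ (i, j) \<in> B (i, j)} \<omega> =
        (\<Prod>p\<in>{..<n} \<times> {..<n}. measure \<mu> (B p)))"

definition sigma_limit ::
  "'a measure \<Rightarrow> nat \<Rightarrow> nat \<Rightarrow> ('a \<Rightarrow> real mat) \<Rightarrow> ('a \<Rightarrow> 's \<Rightarrow> real vec) \<Rightarrow>
   ('a \<Rightarrow> real vec \<Rightarrow> real vec) \<Rightarrow> 'a measure" where
  \<comment> \<open>\<open>\<sigma>(S, \<psi>\<^sub>1, \<psi>\<^sub>2)\<close>: a random function generates the \<open>\<sigma>\<close>-algebra of all its evaluations\<close>
  "sigma_limit M N K S \<psi>\<^sub>1 \<psi>\<^sub>2 = sigma (space M)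
     ({(\<lambda>\<omega>. S \<omega> $$ (i, j)) -` B \<inter> space M | i j B. i < N \<and> j < N \<and> B \<in> sets borel} \<union>
      {(\<lambda>\<omega>. \<psi>\<^sub>1 \<omega> s $ i) -` B \<inter> space M | s i B. i < N \<and> B \<in> sets borel} \<union>
      {(\<lambda>\<omega>. \<psi>\<^sub>2 \<omega> v $ k) -` B \<inter> space M | v k B.
         v \<in> carrier_vec N \<and> k < K \<and> B \<in> sets borel})"

text \<open>
  The parameters of a network: the distinguished layer matrix \<open>W\<^sub>2\<close>, and the remaining ones, namely
  the list of the other weight matrices and the vector of all parameters that are not weights.
\<close>

type_synonym rest_params = "real mat list \<times> real vec"

datatype params = Params (layer: "real mat") (rest: rest_params)

definition weights :: "params \<Rightarrow> real mat list" where
  "weights \<alpha> = layer \<alpha> # fst (rest \<alpha>)"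

definition param_space :: "nat \<Rightarrow> (nat \<times> nat) list \<Rightarrow> nat \<Rightarrow> params set" where
  "param_space N shapes q =
     {\<alpha>. layer \<alpha> \<in> carrier_mat N N \<and>
         map (\<lambda>W. (dim_row W, dim_col W)) (fst (rest \<alpha>)) = shapes \<and>
         snd (rest \<alpha>) \<in> carrier_vec q}"

definition params_dist :: "params \<Rightarrow> params \<Rightarrow> real" where
  "params_dist \<alpha> \<beta> =
     sqrt ((\<Sum>i<length (weights \<alpha>). (frob_norm (weights \<alpha> ! i - weights \<beta> ! i))\<^sup>2) +
           (euclid_norm (snd (rest \<alpha>) - snd (rest \<beta>)))\<^sup>2)"

definition random_params ::
  "'a measure \<Rightarrow> nat \<Rightarrow> (nat \<times> nat) list \<Rightarrow> nat \<Rightarrow> ('a \<Rightarrow> params) \<Rightarrow> bool" where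
  "random_params M N shapes q \<alpha> \<longleftrightarrow>
     \<alpha> \<in> space M \<rightarrow> param_space N shapes q \<and>
     random_mat M N N (\<lambda>\<omega>. layer (\<alpha> \<omega>)) \<and>
     (\<forall>l<length shapes.
        random_mat M (fst (shapes ! l)) (snd (shapes ! l)) (\<lambda>\<omega>. fst (rest (\<alpha> \<omega>)) ! l)) \<and>
     random_vec M q (\<lambda>\<omega>. snd (rest (\<alpha> \<omega>)))"

definition softmax :: "real vec \<Rightarrow> real vec" where
  "softmax v = vec (dim_vec v) (\<lambda>i. exp (v $ i) / (\<Sum>j<dim_vec v. exp (v $ j)))"

definition loss ::
  "real \<Rightarrow> 's set \<Rightarrow> ('s \<Rightarrow> nat) \<Rightarrow> ('s \<Rightarrow> params \<Rightarrow> real vec) \<Rightarrow> params \<Rightarrow> real" where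
  "loss lam T C X \<alpha> =
     - (1 / real (card T)) * (\<Sum>s\<in>T. ln (softmax (X s \<alpha>) $ C s)) +
     lam * (\<Sum>W\<leftarrow>weights \<alpha>. (frob_norm W)\<^sup>2)"

definition scaled_layer :: "real mat \<Rightarrow> real mat \<Rightarrow> real \<Rightarrow> real mat" where
  "scaled_layer S R \<theta> = S + \<theta> \<cdot>\<^sub>m R"

definition lip_const :: "(real vec \<Rightarrow> real vec) \<Rightarrow> real vec set \<Rightarrow> ennreal" where
  \<comment> \<open>equals 0 if \<open>U\<close> has fewer than two elements\<close>
  "lip_const f U =
     (SUP (v, w)\<in>{(v, w). v \<in> U \<and> w \<in> U \<and> v \<noteq> w}.
        ennreal (max_norm (f v - f w) / max_norm (v - w)))"

text \<open>
  All quantities carry the layer size \<open>N\<close> as first argument, each \<open>N\<close> having its own probability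
  space \<open>M N\<close>; assumptions at fixed \<open>N\<close> are only made for \<open>N > 0\<close>. \<open>X N s \<alpha>\<close> are the logits,
  \<open>\<alpha> N t\<close> is the training path, \<open>\<alpha>s N\<close> its limit. \<open>\<psi>\<^sub>1 N\<close> and \<open>\<psi>\<^sub>2 N\<close> take the remaining
  parameters as argument; \<open>\<Psi>\<^sub>1 N\<close> and \<open>\<Psi>\<^sub>2 N\<close> are the random functions obtained from them at
  \<open>\<alpha>s N\<close>, and \<open>\<F> N\<close> is the \<open>\<sigma>\<close>-algebra on which one conditions.
\<close>

locale limit_layer_data =
  fixes M :: "nat \<Rightarrow> 'a measure"
    and K :: nat
    and T :: "'s set"
    and C :: "'s \<Rightarrow> nat"
    and lam :: real
    and shapes :: "nat \<Rightarrow> (nat \<times> nat) list"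
    and q :: "nat \<Rightarrow> nat"
    and X :: "nat \<Rightarrow> 's \<Rightarrow> params \<Rightarrow> real vec"
    and \<alpha> :: "nat \<Rightarrow> real \<Rightarrow> 'a \<Rightarrow> params"
    and \<alpha>s :: "nat \<Rightarrow> 'a \<Rightarrow> params"
    and S R :: "nat \<Rightarrow> 'a \<Rightarrow> real mat"
    and \<psi>\<^sub>1 :: "nat \<Rightarrow> rest_params \<Rightarrow> 's \<Rightarrow> real vec"
    and \<psi>\<^sub>2 :: "nat \<Rightarrow> rest_params \<Rightarrow> real vec \<Rightarrow> real vec"
    and g :: "nat \<Rightarrow> real"
    and U :: "nat \<Rightarrow> 'a \<Rightarrow> 's \<Rightarrow> real vec set"
    and d\<^sub>1 d\<^sub>2 :: "nat \<Rightarrow> real"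
    and J :: "real vec \<Rightarrow> real"
    and eps :: "nat \<Rightarrow> 'a \<Rightarrow> real"
begin

definition W\<^sub>2 :: "nat \<Rightarrow> 'a \<Rightarrow> real mat" where
  "W\<^sub>2 N \<omega> = layer (\<alpha>s N \<omega>)"

definition \<Psi>\<^sub>1 :: "nat \<Rightarrow> 'a \<Rightarrow> 's \<Rightarrow> real vec" where
  "\<Psi>\<^sub>1 N \<omega> = \<psi>\<^sub>1 N (rest (\<alpha>s N \<omega>))"

definition \<Psi>\<^sub>2 :: "nat \<Rightarrow> 'a \<Rightarrow> real vec \<Rightarrow> real vec" where
  "\<Psi>\<^sub>2 N \<omega> = \<psi>\<^sub>2 N (rest (\<alpha>s N \<omega>))"

definition \<F> :: "nat \<Rightarrow> 'a measure" where
  "\<F> N = sigma_limit (M N) N K (S N) (\<Psi>\<^sub>1 N) (\<Psi>\<^sub>2 N)"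

definition alpha_scaled :: "nat \<Rightarrow> real \<Rightarrow> 'a \<Rightarrow> params" where
  "alpha_scaled N \<theta> \<omega> = Params (scaled_layer (S N \<omega>) (R N \<omega>) \<theta>) (rest (\<alpha>s N \<omega>))"

definition net_loss :: "nat \<Rightarrow> params \<Rightarrow> real" where
  "net_loss N = loss lam T C (X N)"

definition L\<psi>\<^sub>2 :: "nat \<Rightarrow> 'a \<Rightarrow> 's \<Rightarrow> ennreal" where
  "L\<psi>\<^sub>2 N \<omega> s = lip_const (\<Psi>\<^sub>2 N \<omega>) (U N \<omega> s)"

definition a\<^sub>\<phi> :: "nat \<Rightarrow> 's \<Rightarrow> 'a \<Rightarrow> real" where
  "a\<^sub>\<phi> N s \<omega> = J (\<Psi>\<^sub>1 N \<omega> s) * enn2real (L\<psi>\<^sub>2 N \<omega> s) * d\<^sub>1 N"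

end

locale gaussian_limit_layer = limit_layer_data +
  assumes prob_space: "N > 0 \<Longrightarrow> prob_space (M N)"
    and T: "finite T" "T \<noteq> {}"
    and C: "s \<in> T \<Longrightarrow> C s < K"
    and lam: "lam > 0"
    and logits: "N > 0 \<Longrightarrow> \<beta> \<in> param_space N (shapes N) (q N) \<Longrightarrow> X N s \<beta> \<in> carrier_vec K"
    and path: "N > 0 \<Longrightarrow> t \<ge> 0 \<Longrightarrow> random_params (M N) N (shapes N) (q N) (\<alpha> N t)"
    and limit: "N > 0 \<Longrightarrow> random_params (M N) N (shapes N) (q N) (\<alpha>s N)"
    and path_conv:
      "N > 0 \<Longrightarrow> conv_prob (\<lambda>_. M N) (\<lambda>t \<omega>. params_dist (\<alpha> N t \<omega>) (\<alpha>s N \<omega>)) 0 at_top"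
    and S: "N > 0 \<Longrightarrow> random_mat (M N) N N (S N)"
    and R: "N > 0 \<Longrightarrow> random_mat (M N) N N (R N)"
    and decomposition: "N > 0 \<Longrightarrow> \<omega> \<in> space (M N) \<Longrightarrow> W\<^sub>2 N \<omega> = S N \<omega> + R N \<omega>"
    and \<Psi>\<^sub>1: "N > 0 \<Longrightarrow> random_vec (M N) N (\<lambda>\<omega>. \<Psi>\<^sub>1 N \<omega> s)"
    and \<Psi>\<^sub>2: "N > 0 \<Longrightarrow> v \<in> carrier_vec N \<Longrightarrow> random_vec (M N) K (\<lambda>\<omega>. \<Psi>\<^sub>2 N \<omega> v)"
  \<comment> \<open>\<open>\<theta> = 1\<close> is the factorization at \<open>\<alpha>\<^sup>*\<close>; as \<open>\<psi>\<^sub>1\<close> and \<open>\<psi>\<^sub>2\<close> depend only on the remaining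
      parameters, they are the same functions along the whole segment\<close>
    and factorization: "N > 0 \<Longrightarrow> AE \<omega> in M N. \<forall>\<theta>\<in>{0..1}. \<forall>s.
          softmax (X N s (alpha_scaled N \<theta> \<omega>)) =
          softmax (\<Psi>\<^sub>2 N \<omega> (scaled_layer (S N \<omega>) (R N \<omega>) \<theta> *\<^sub>v \<Psi>\<^sub>1 N \<omega> s))"
    and g: "N > 0 \<Longrightarrow> g N \<ge> 0"
    and gaussian: "N > 0 \<Longrightarrow> cond_iid_entries (M N) (\<F> N) N (R N) (gaussian (g N / real N))"
    and U: "N > 0 \<Longrightarrow> s \<in> T \<Longrightarrow> AE \<omega> in M N.
          (\<lambda>\<theta>. scaled_layer (S N \<omega>) (R N \<omega>) \<theta> *\<^sub>v \<Psi>\<^sub>1 N \<omega> s) ` {0..1} \<subseteq> U N \<omega> s \<and>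
          U N \<omega> s \<subseteq> carrier_vec N \<and> L\<psi>\<^sub>2 N \<omega> s < \<infinity>"
  \<comment> \<open>\<open>J\<close> is arbitrary, so \<open>bound\<close> has to include the measurability of the event: \<^const>\<open>real_cond_exp\<close>
      of a nonmeasurable function is 0 by convention\<close>
    and d: "N > 0 \<Longrightarrow> d\<^sub>1 N \<ge> 0" "N > 0 \<Longrightarrow> d\<^sub>2 N \<ge> 0" "d\<^sub>1 \<longlonglongrightarrow> 0" "d\<^sub>2 \<longlonglongrightarrow> 0"
    and J: "J v \<ge> 0"
    and bound: "N > 0 \<Longrightarrow> random_vec (\<F> N) N V \<Longrightarrow>
          {\<omega> \<in> space (M N). max_norm (R N \<omega> *\<^sub>v V \<omega>) > d\<^sub>1 N * J (V \<omega>)} \<in> sets (M N) \<and>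
          (AE \<omega> in M N. cond_prob_sigma (M N) (\<F> N)
             {\<omega> \<in> space (M N). max_norm (R N \<omega> *\<^sub>v V \<omega>) > d\<^sub>1 N * J (V \<omega>)} \<omega> \<le> d\<^sub>2 N)"
    and a\<^sub>\<phi>: "s \<in> T \<Longrightarrow> conv_prob M (\<lambda>N. a\<^sub>\<phi> N s) 0 sequentially"
    and orthogonal: "conv_prob M (\<lambda>N \<omega>. frob_inner (S N \<omega>) (R N \<omega>)) 0 sequentially"
    and eps_nonneg: "N > 0 \<Longrightarrow> \<omega> \<in> space (M N) \<Longrightarrow> eps N \<omega> \<ge> 0"
    and eps: "N > 0 \<Longrightarrow> eps N \<in> borel_measurable (M N)" "conv_prob M eps 0 sequentially"
    and minimal: "(\<lambda>N. measure (M N) {\<omega> \<in> space (M N).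
          Liminf (at_right 0) (\<lambda>h. ereal
            ((net_loss N (alpha_scaled N (1 - h) \<omega>) - net_loss N (\<alpha>s N \<omega>)) / h))
          \<ge> ereal (- eps N \<omega>)}) \<longlonglongrightarrow> 1"

end

theory Submission
  imports Defs
begin

text \<open>
  The first-order condition along \<open>\<theta> \<mapsto> S + \<theta> R\<close> forces \<open>R\<close> to vanish in Frobenius norm. Replacing
  \<open>\<theta> = 1\<close> by \<open>\<theta> = 1 - h\<close> costs at most \<open>2 h\<close> times the mean of \<open>a\<^sub>\<phi>\<close> in cross entropy, off an event of
  probability at most \<open>|T| d\<^sub>2\<close>, and gains \<open>2 h lam (\<langle>S, R\<rangle> + \<parallel>R\<parallel>\<^sup>2) + O(h\<^sup>2)\<close> in the penalty. Almost
  minimality therefore bounds \<open>\<parallel>R\<parallel>\<^sup>2\<close> by a quantity that tends to 0 in probability. The claims on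
  singular values follow from Weyl's and Ky Fan's inequalities, with errors measured in Frobenius
  norm.
\<close>

section \<open>Euclidean, Frobenius and operator norms\<close>

text \<open>The Frobenius norm, rather than the operator norm, has to be controlled: a tail sum may
  contain almost N squared singular values, and perturbing each by at most the operator norm of R
  could cost N times its square. The quadratic penalty yields the Frobenius norm directly. No
  derivative of the network is taken: psi_2 is only Lipschitz, so the loss is compared at two
  points, and the right-sided liminf is bounded by the limit of an explicit affine function of h.
  The cross entropy rises by at most h times a vanishing quantity, so it cannot offset the
  first-order gain in the penalty unless R is small. Singular values are given as roots of a
  characteristic polynomial, a form unsuited to inequalities. The spectral theorem turns them into
  the weights of the quadratic form |A x|^2, which is what both perturbation inequalities use.
  Convergence in probability also demands measurability, for which roots and suprema offer no direct
  formula; being 1-Lipschitz for the Frobenius norm settles it, so the perturbation bound does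
  double duty.\<close>

lemma euclid_norm_L2: "euclid_norm v = L2_set (\<lambda>i. v $ i) {..<dim_vec v}"
  by (simp add: euclid_norm_def L2_set_def)

lemma euclid_norm_sq: "(euclid_norm v)\<^sup>2 = scalar_prod v v"
  unfolding euclid_norm_def scalar_prod_def
  by (subst real_sqrt_pow2) (auto simp: power2_eq_square lessThan_atLeast0 intro!: sum_nonneg)

lemma euclid_norm_nonneg [simp]: "euclid_norm v \<ge> 0"
  by (simp add: euclid_norm_def sum_nonneg)

lemma euclid_norm_triangle:
  assumes "v \<in> carrier_vec n" "w \<in> carrier_vec n"
  shows "euclid_norm (v + w) \<le> euclid_norm v + euclid_norm w"
proof -
  have "euclid_norm (v + w) = L2_set (\<lambda>i. v $ i + w $ i) {..<n}"
    using assms by (auto simp: euclid_norm_L2 intro!: L2_set_cong)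
  then show ?thesis
    using assms L2_set_triangle_ineq[of "\<lambda>i. v $ i" "\<lambda>i. w $ i" "{..<n}"] by (simp add: euclid_norm_L2)
qed

lemma abs_scalar_prod_le:
  fixes v w :: "real vec"
  assumes "v \<in> carrier_vec n" "w \<in> carrier_vec n"
  shows "\<bar>scalar_prod v w\<bar> \<le> euclid_norm v * euclid_norm w"
proof -
  have "\<bar>scalar_prod v w\<bar> \<le> (\<Sum>i\<in>{..<n}. \<bar>v $ i\<bar> * \<bar>w $ i\<bar>)"
    using assms by (auto simp: scalar_prod_def lessThan_atLeast0 abs_mult intro!: sum_abs[THEN order_trans])
  also have "\<dots> \<le> L2_set (\<lambda>i. v $ i) {..<n} * L2_set (\<lambda>i. w $ i) {..<n}"
    by (rule L2_set_mult_ineq)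
  finally show ?thesis using assms by (simp add: euclid_norm_L2)
qed

lemma frob_inner_self_nonneg: "frob_inner A A \<ge> 0"
  by (auto simp: frob_inner_def intro!: sum_nonneg)

lemma frob_norm_nonneg [simp]: "frob_norm A \<ge> 0"
  by (simp add: frob_norm_def frob_inner_self_nonneg)

lemma frob_norm_sq: "(frob_norm A)\<^sup>2 = frob_inner A A"
  by (simp add: frob_norm_def frob_inner_self_nonneg)

lemma frob_norm_sq_rows: "(frob_norm A)\<^sup>2 = (\<Sum>i<dim_row A. (euclid_norm (row A i))\<^sup>2)"
  unfolding frob_norm_sq frob_inner_def euclid_norm_def
  by (intro sum.cong refl, subst real_sqrt_pow2) (auto simp: power2_eq_square intro!: sum_nonneg)

lemma euclid_norm_mult_vec_le:
  assumes "A \<in> carrier_mat m n" "v \<in> carrier_vec n"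
  shows "euclid_norm (A *\<^sub>v v) \<le> frob_norm A * euclid_norm v"
proof (rule power2_le_imp_le)
  have "(euclid_norm (A *\<^sub>v v))\<^sup>2 = (\<Sum>i<m. (scalar_prod (row A i) v)\<^sup>2)"
    unfolding euclid_norm_def using assms
    by (subst real_sqrt_pow2) (auto intro!: sum_nonneg)
  also have "\<dots> \<le> (\<Sum>i<m. (euclid_norm (row A i) * euclid_norm v)\<^sup>2)"
    using assms
    by (intro sum_mono, subst power2_abs[symmetric], intro power_mono abs_scalar_prod_le[of _ n]) auto
  also have "\<dots> = (frob_norm A * euclid_norm v)\<^sup>2"
    using assms by (simp add: power_mult_distrib frob_norm_sq_rows sum_distrib_right)
  finally show "(euclid_norm (A *\<^sub>v v))\<^sup>2 \<le> (frob_norm A * euclid_norm v)\<^sup>2" .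
qed auto

lemma op_norm_bound:
  assumes "A \<in> carrier_mat m n" "c \<ge> 0"
    and "\<And>v. v \<in> carrier_vec n \<Longrightarrow> euclid_norm v \<le> 1 \<Longrightarrow> euclid_norm (A *\<^sub>v v) \<le> c"
  shows "op_norm A \<le> c"
  unfolding op_norm_def using assms
  \<comment> \<open>The zero vector shows that the unit ball is nonempty.\<close>
  by (intro cSUP_least) (auto intro!: exI[of _ "0\<^sub>v n"] simp: euclid_norm_def)

text \<open>A real \<open>SUP\<close> is an upper bound only for sets that are bounded
  above.\<close>

lemma bdd_above_op_norm:
  "bdd_above ((\<lambda>v. euclid_norm (A *\<^sub>v v)) ` {v \<in> carrier_vec (dim_col A). euclid_norm v \<le> 1})"
proof (intro bdd_aboveI2)
  fix v assume v: "v \<in> {v \<in> carrier_vec (dim_col A). euclid_norm v \<le> 1}"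
  have "euclid_norm (A *\<^sub>v v) \<le> frob_norm A * euclid_norm v"
    using v by (intro euclid_norm_mult_vec_le[of _ "dim_row A" "dim_col A"]) auto
  also have "\<dots> \<le> frob_norm A * 1" using v by (intro mult_left_mono) auto
  finally show "euclid_norm (A *\<^sub>v v) \<le> frob_norm A" by simp
qed

lemma euclid_norm_mult_vec_le_op_norm:
  assumes "A \<in> carrier_mat m n" "v \<in> carrier_vec n" "euclid_norm v \<le> 1"
  shows "euclid_norm (A *\<^sub>v v) \<le> op_norm A"
  unfolding op_norm_def using assms by (intro cSUP_upper bdd_above_op_norm) auto

lemma op_norm_nonneg [simp]: "op_norm A \<ge> 0"
proof -
  have "euclid_norm (A *\<^sub>v 0\<^sub>v (dim_col A)) \<le> op_norm A"
    by (rule euclid_norm_mult_vec_le_op_norm[of _ "dim_row A" "dim_col A"]) (auto simp: euclid_norm_def)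
  then show ?thesis using euclid_norm_nonneg order_trans by blast
qed

lemma op_norm_le_frob_norm: "op_norm A \<le> frob_norm A"
proof (rule op_norm_bound[of _ "dim_row A" "dim_col A"])
  fix v :: "real vec" assume v: "v \<in> carrier_vec (dim_col A)" "euclid_norm v \<le> 1"
  have "euclid_norm (A *\<^sub>v v) \<le> frob_norm A * euclid_norm v"
    using v by (intro euclid_norm_mult_vec_le[of _ "dim_row A" "dim_col A"]) auto
  also have "\<dots> \<le> frob_norm A * 1" using v by (intro mult_left_mono) auto
  finally show "euclid_norm (A *\<^sub>v v) \<le> frob_norm A" by simp
qed auto

lemma mult_vec_split_diff:
  fixes A B :: "real mat"
  assumes "A \<in> carrier_mat m n" "B \<in> carrier_mat m n" "v \<in> carrier_vec n"
  shows "A *\<^sub>v v = B *\<^sub>v v + (A - B) *\<^sub>v v"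
  using assms by (intro eq_vecI) (auto simp: scalar_prod_def algebra_simps simp flip: sum.distrib)

text \<open>One-sided, with the Frobenius norm as error: the form from which measurability of the
  operator norm of a random matrix is derived below.\<close>

lemma op_norm_lipschitz:
  assumes A: "A \<in> carrier_mat m n" and B: "B \<in> carrier_mat m n"
  shows "op_norm A \<le> op_norm B + frob_norm (A - B)"
proof (rule op_norm_bound[OF A])
  fix v :: "real vec" assume v: "v \<in> carrier_vec n" "euclid_norm v \<le> 1"
  have "euclid_norm (A *\<^sub>v v) \<le> euclid_norm (B *\<^sub>v v) + euclid_norm ((A - B) *\<^sub>v v)"
    unfolding mult_vec_split_diff[OF A B v(1)] using A B v
    by (intro euclid_norm_triangle[of _ m] mult_mat_vec_carrier[of _ m n] minus_carrier_mat) auto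
  also have "euclid_norm (B *\<^sub>v v) \<le> op_norm B"
    using euclid_norm_mult_vec_le_op_norm[OF B v] .
  also have "euclid_norm ((A - B) *\<^sub>v v) \<le> op_norm (A - B)"
    using A B v by (intro euclid_norm_mult_vec_le_op_norm[of _ m n] minus_carrier_mat) auto
  also have "\<dots> \<le> frob_norm (A - B)" by (rule op_norm_le_frob_norm)
  finally show "euclid_norm (A *\<^sub>v v) \<le> op_norm B + frob_norm (A - B)" by simp
qed auto

section \<open>The spectral theorem for real symmetric matrices\<close>

text \<open>An eigenvector of the complexification is split into its real part x and imaginary part
  y. Symmetry forces the eigenvalue to be real; then x and y each satisfy the eigenvalue equation,
  and a nonzero one can be normalised.\<close>

lemma symmetric_real_eigenvalue:
  fixes A :: "real mat"
  assumes A: "A \<in> carrier_mat n n" "transpose_mat A = A" and n: "n > 0"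
  obtains \<mu> u where "u \<in> carrier_vec n" "scalar_prod u u = 1" "A *\<^sub>v u = \<mu> \<cdot>\<^sub>v u"
proof -
  let ?A = "map_mat complex_of_real A"
  have Ac: "?A \<in> carrier_mat n n" using A by simp
  have "degree (char_poly ?A) = n" using degree_monic_char_poly[OF Ac] by simp
  then obtain z where "poly (char_poly ?A) z = 0"
    using fundamental_theorem_of_algebra[of "char_poly ?A"] n
    by (metis constant_degree neq0_conv)
  then have "eigenvalue ?A z" using eigenvalue_root_char_poly[OF Ac] by simp
  then obtain v where v: "v \<in> carrier_vec n" "v \<noteq> 0\<^sub>v n" "?A *\<^sub>v v = z \<cdot>\<^sub>v v"
    using Ac by (auto simp: eigenvalue_def eigenvector_def)
  define x where "x = map_vec Re v"
  define y where "y = map_vec Im v"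
  have c [simp]: "x \<in> carrier_vec n" "y \<in> carrier_vec n" using v by (auto simp: x_def y_def)
  have comp: "(\<Sum>j<n. complex_of_real (A $$ (i, j)) * v $ j) = z * v $ i" if "i < n" for i
  proof -
    have "(\<Sum>j<n. complex_of_real (A $$ (i, j)) * v $ j) = (?A *\<^sub>v v) $ i"
      using that A v(1) by (simp add: scalar_prod_def lessThan_atLeast0)
    then show ?thesis using that v by simp
  qed
  have Ax: "A *\<^sub>v x = Re z \<cdot>\<^sub>v x - Im z \<cdot>\<^sub>v y"
    using A v arg_cong[OF comp, of _ Re]
    by (intro eq_vecI) (auto simp: scalar_prod_def x_def y_def lessThan_atLeast0)
  have Ay: "A *\<^sub>v y = Im z \<cdot>\<^sub>v x + Re z \<cdot>\<^sub>v y"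
    using A v arg_cong[OF comp, of _ Im]
    by (intro eq_vecI) (auto simp: scalar_prod_def x_def y_def lessThan_atLeast0)
  have pos: "0 < scalar_prod x x + scalar_prod y y"
  proof -
    obtain i where i: "i < n" "v $ i \<noteq> 0" using v by (metis carrier_vecD eq_vecI index_zero_vec)
    have "0 < (\<Sum>i<n. (Re (v $ i))\<^sup>2 + (Im (v $ i))\<^sup>2)"
      by (rule sum_pos2[of _ i]) (use i in \<open>auto simp: complex_neq_0\<close>)
    then show ?thesis
      using v by (simp add: scalar_prod_def x_def y_def lessThan_atLeast0 power2_eq_square sum.distrib)
  qed
  \<comment> \<open>The left side contributes \<open>- Im z\<close> times |y|^2, the right side
    \<open>Im z\<close> times |x|^2; the terms with \<open>Re z\<close> cancel.\<close>
  have "scalar_prod (A *\<^sub>v x) y = scalar_prod x (A *\<^sub>v y)"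
    using transpose_vec_mult_scalar[OF A(1) c(2) c(1)] A(2) by simp
  then have "Im z * (scalar_prod x x + scalar_prod y y) = 0"
    using c unfolding Ax Ay
    by (simp add: minus_scalar_prod_distrib[of _ n] scalar_prod_add_distrib[of _ n] algebra_simps)
  then have z: "Im z = 0" using pos by simp
  have "\<exists>w \<in> {x, y}. scalar_prod w w > 0"
    using pos by fastforce
  then obtain w where w: "w \<in> {x, y}" "scalar_prod w w > 0" by blast
  have wc: "w \<in> carrier_vec n" using w by auto
  have Aw: "A *\<^sub>v w = Re z \<cdot>\<^sub>v w" using w Ax Ay z by (auto simp: x_def y_def intro!: eq_vecI)
  define u where "u = (1 / sqrt (scalar_prod w w)) \<cdot>\<^sub>v w"
  show thesis
  proof (rule that[of u])
    show "u \<in> carrier_vec n" using wc by (simp add: u_def)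
    show "scalar_prod u u = 1" using w wc by (simp add: u_def)
    show "A *\<^sub>v u = Re z \<cdot>\<^sub>v u"
      using A wc by (simp add: u_def mult_mat_vec[of _ n n] Aw smult_smult_assoc mult.commute)
  qed
qed

text \<open>Householder reflection along e_0 - u: it exchanges e_0 and u because both have norm
  1.\<close>

lemma unit_vec_reflection:
  fixes u :: "real vec"
  assumes u: "u \<in> carrier_vec (Suc n)" "scalar_prod u u = 1"
  obtains H where "H \<in> carrier_mat (Suc n) (Suc n)" "transpose_mat H = H" "H * H = 1\<^sub>m (Suc n)"
    "H *\<^sub>v unit_vec (Suc n) 0 = u"
proof -
  define w where "w = unit_vec (Suc n) 0 - u"
  \<comment> \<open>If u is e_0 then w = 0, and division by zero gives c = 0, so that H is the
    identity, as it should be.\<close>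
  define c where "c = 2 / scalar_prod w w"
  define H where "H = mat (Suc n) (Suc n) (\<lambda>(i, j). of_bool (i = j) - c * w $ i * w $ j)"
  have wc: "w \<in> carrier_vec (Suc n)" using u by (simp add: w_def)
  \<comment> \<open>|e_0 - u|^2 = 2 - 2 u_0, which is twice entry 0 of w.\<close>
  have ww: "scalar_prod w w = 2 * w $ 0"
    using u by (simp add: w_def minus_scalar_prod_distrib[of _ "Suc n"]
      scalar_prod_minus_distrib[of _ "Suc n"] scalar_prod_left_unit scalar_prod_right_unit)
  \<comment> \<open>c w_0 = 1 unless w vanishes; this yields H e_0 = e_0 - c w_0 w = e_0 - w =
    u.\<close>
  have cw: "c * w $ 0 * w $ i = w $ i" if "i < Suc n" for i
  proof (cases "w $ 0 = 0")
    case True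
    then have "(\<Sum>i<Suc n. (w $ i)\<^sup>2) = 0"
      using ww wc by (simp add: scalar_prod_def power2_eq_square lessThan_atLeast0 del: sum.lessThan_Suc sum.op_ivl_Suc)
    then show ?thesis using that by (subst (asm) sum_nonneg_eq_0_iff) auto
  qed (simp add: c_def ww)
  show thesis
  proof (rule that[of H])
    show "H \<in> carrier_mat (Suc n) (Suc n)" by (simp add: H_def)
    show "transpose_mat H = H" by (auto simp: H_def)
    show "H * H = 1\<^sub>m (Suc n)"
    proof (intro eq_matI)
      fix i j assume ij: "i < dim_row (1\<^sub>m (Suc n) :: real mat)" "j < dim_col (1\<^sub>m (Suc n) :: real mat)"
      have "(H * H) $$ (i, j) =
          (\<Sum>l<Suc n. (of_bool (i = l) - c * w $ i * w $ l) * (of_bool (l = j) - c * w $ l * w $ j))"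
        using ij by (simp add: H_def scalar_prod_def lessThan_atLeast0 del: sum.lessThan_Suc sum.op_ivl_Suc)
      also have "\<dots> = (\<Sum>l<Suc n. (if l = i then of_bool (l = j) - c * w $ l * w $ j else 0) -
          (if l = j then c * w $ i * w $ l else 0) + c * c * w $ i * w $ j * (w $ l * w $ l))"
        by (intro sum.cong) (auto simp: algebra_simps)
      also have "\<dots> = of_bool (i = j) - c * w $ i * w $ j - c * w $ i * w $ j
          + c * c * w $ i * w $ j * scalar_prod w w"
        using ij wc by (simp add: sum.distrib sum_subtractf scalar_prod_def lessThan_atLeast0
          del: sum.lessThan_Suc sum.op_ivl_Suc flip: sum_distrib_left)
      \<comment> \<open>\<open>c * c * scalar_prod w w\<close> equals 2 c, also in the degenerate
        case c = 0.\<close>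
      also have "\<dots> = of_bool (i = j)"
        by (simp add: c_def)
      finally show "(H * H) $$ (i, j) = 1\<^sub>m (Suc n) $$ (i, j)" using ij by simp
    qed (auto simp: H_def)
    show "H *\<^sub>v unit_vec (Suc n) 0 = u"
      using u cw by (intro eq_vecI) (auto simp: H_def scalar_prod_right_unit w_def algebra_simps)
  qed
qed

text \<open>Deflation: conjugation with the reflection that takes an eigenvector to e_0 splits off a
  1 by 1 block and leaves a symmetric matrix of size one less.\<close>

lemma spectral_theorem_mat:
  fixes A :: "real mat"
  assumes "A \<in> carrier_mat n n" "transpose_mat A = A"
  obtains Q D where "Q \<in> carrier_mat n n" "D \<in> carrier_mat n n" "diagonal_mat D"
    "transpose_mat Q * Q = 1\<^sub>m n" "A = Q * D * transpose_mat Q"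
proof -
  have "\<exists>Q D. Q \<in> carrier_mat n n \<and> D \<in> carrier_mat n n \<and> diagonal_mat D \<and>
    transpose_mat Q * Q = 1\<^sub>m n \<and> A = Q * D * transpose_mat Q"
    using assms
  proof (induction n arbitrary: A)
    case 0
    then show ?case by (intro exI[of _ "0\<^sub>m 0 0"]) (auto simp: diagonal_mat_def)
  next
    case (Suc n)
    note A = Suc.prems
    obtain \<mu> u where u: "u \<in> carrier_vec (Suc n)" "scalar_prod u u = 1" "A *\<^sub>v u = \<mu> \<cdot>\<^sub>v u"
      using symmetric_real_eigenvalue[OF A] by blast
    obtain H where H: "H \<in> carrier_mat (Suc n) (Suc n)" "transpose_mat H = H"
      "H * H = 1\<^sub>m (Suc n)" "H *\<^sub>v unit_vec (Suc n) 0 = u"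
      using unit_vec_reflection[OF u(1,2)] by blast
    let ?e = "unit_vec (Suc n) 0 :: real vec"
    define B where "B = H * A * H"
    have B: "B \<in> carrier_mat (Suc n) (Suc n)" using A H by (simp add: B_def)
    have Bs: "transpose_mat B = B"
      using A H by (simp add: B_def transpose_mult[of _ "Suc n" "Suc n" _ "Suc n"])
    have Hu: "H *\<^sub>v u = ?e"
    proof -
      have "H *\<^sub>v u = (H * H) *\<^sub>v ?e"
        unfolding H(4)[symmetric] using H(1) by (simp add: assoc_mult_mat_vec[of _ "Suc n" "Suc n" _ "Suc n"])
      then show ?thesis using H(3) by simp
    qed
    have "B *\<^sub>v ?e = \<mu> \<cdot>\<^sub>v ?e"
      unfolding B_def using A H u Hu
      by (simp add: assoc_mult_mat_vec[of _ "Suc n" "Suc n" _ "Suc n"] mult_mat_vec[of _ "Suc n" "Suc n"])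
    then have B0: "B $$ (i, 0) = (if i = 0 then \<mu> else 0)" if "i < Suc n" for i
    proof -
      have "(B *\<^sub>v ?e) $ i = B $$ (i, 0)" using that B by (simp add: scalar_prod_right_unit)
      then show ?thesis using \<open>B *\<^sub>v ?e = \<mu> \<cdot>\<^sub>v ?e\<close> that by (auto split: if_splits)
    qed
    \<comment> \<open>Symmetry carries the zeros of column 0 over to row 0.\<close>
    have B0': "B $$ (0, i) = (if i = 0 then \<mu> else 0)" if "i < Suc n" for i
      using B0[OF that] that B arg_cong[OF Bs, of "\<lambda>X. X $$ (i, 0)"] by simp
    define B' where "B' = mat n n (\<lambda>(i, j). B $$ (Suc i, Suc j))"
    let ?m = "mat 1 1 (\<lambda>_. \<mu>) :: real mat"
    have Bblock: "B = four_block_mat ?m (0\<^sub>m 1 n) (0\<^sub>m n 1) B'"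
      using B B0 B0' by (intro eq_matI) (auto simp: B'_def)
    have B': "B' \<in> carrier_mat n n" by (simp add: B'_def)
    have B's: "transpose_mat B' = B'"
    proof (intro eq_matI)
      fix i j assume "i < dim_row B'" "j < dim_col B'"
      then show "transpose_mat B' $$ (i, j) = B' $$ (i, j)"
        using B arg_cong[OF Bs, of "\<lambda>X. X $$ (Suc i, Suc j)"] by (simp add: B'_def)
    qed (simp_all add: B'_def)
    from Suc.IH[OF B' B's] obtain Q D where Q: "Q \<in> carrier_mat n n" and D: "D \<in> carrier_mat n n"
      "diagonal_mat D" and QQ: "transpose_mat Q * Q = 1\<^sub>m n" and B'Q: "B' = Q * D * transpose_mat Q"
      by blast
    \<comment> \<open>Q and D are bordered so that B = P E P^T, whence A = (H P) E (H P)^T.\<close>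
    define P where "P = four_block_mat (1\<^sub>m 1) (0\<^sub>m 1 n) (0\<^sub>m n 1) Q"
    define E where "E = four_block_mat ?m (0\<^sub>m 1 n) (0\<^sub>m n 1) D"
    have P: "P \<in> carrier_mat (Suc n) (Suc n)" and E: "E \<in> carrier_mat (Suc n) (Suc n)"
      using Q D by (auto simp: P_def E_def four_block_mat_def Let_def)
    have Pt: "transpose_mat P = four_block_mat (1\<^sub>m 1) (0\<^sub>m 1 n) (0\<^sub>m n 1) (transpose_mat Q)"
      unfolding P_def using Q by (subst transpose_four_block_mat[of _ 1 1 _ n _ n]) auto
    have PP: "transpose_mat P * P = 1\<^sub>m (Suc n)"
      unfolding Pt unfolding P_def using Q QQ
      by (subst mult_four_block_mat[of _ 1 1 _ n _ n _ _ 1 _ n]) (auto intro!: eq_matI)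
    have PE: "P * E = four_block_mat ?m (0\<^sub>m 1 n) (0\<^sub>m n 1) (Q * D)"
      unfolding P_def E_def using Q D
      by (subst mult_four_block_mat[of _ 1 1 _ n _ n _ _ 1 _ n]) (auto intro!: cong_four_block_mat)
    have PEP: "P * E * transpose_mat P = B"
      unfolding PE Pt Bblock B'Q using Q D
      by (subst mult_four_block_mat[of _ 1 1 _ n _ n _ _ 1 _ n]) (auto intro!: cong_four_block_mat)
    note [simp] = assoc_mult_mat[of _ "Suc n" "Suc n" _ "Suc n" _ "Suc n"]
    \<comment> \<open>With products associated to the right, H H = 1 no longer shows up as a factor
      of its own.\<close>
    have HHX: "H * (H * X) = X" if "X \<in> carrier_mat (Suc n) (Suc n)" for X
    proof -
      have "H * (H * X) = (H * H) * X" using H(1) that by simp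
      then show ?thesis using H(3) that by simp
    qed
    show ?case
    proof (intro exI conjI)
      show "H * P \<in> carrier_mat (Suc n) (Suc n)" using H P by simp
      show "E \<in> carrier_mat (Suc n) (Suc n)" by fact
      show "diagonal_mat E"
        using D by (auto simp: diagonal_mat_def E_def)
      have t: "transpose_mat (H * P) = transpose_mat P * H"
        using H P by (simp add: transpose_mult[of _ "Suc n" "Suc n" _ "Suc n"])
      show "transpose_mat (H * P) * (H * P) = 1\<^sub>m (Suc n)"
        unfolding t using H(1) P HHX PP by simp
      have "H * P * E * transpose_mat (H * P) = H * (P * E * transpose_mat P) * H"
        unfolding t using H(1) P E by simp
      also have "\<dots> = A" unfolding PEP B_def using H(1,3) A HHX by simp
      finally show "A = H * P * E * transpose_mat (H * P)" by simp
    qed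
  qed
  then show thesis using that by blast
qed

section \<open>Perturbation of singular values\<close>

lemma orthogonal_mat_euclid_norm:
  fixes Q :: "real mat"
  assumes Q: "Q \<in> carrier_mat n n" "transpose_mat Q * Q = 1\<^sub>m n" and x: "x \<in> carrier_vec n"
  shows "euclid_norm (Q *\<^sub>v x) = euclid_norm x"
    and "euclid_norm (transpose_mat Q *\<^sub>v x) = euclid_norm x"
proof -
  have QQ: "Q * transpose_mat Q = 1\<^sub>m n"
    using Q mat_mult_left_right_inverse[of "transpose_mat Q" n Q] by simp
  have "scalar_prod (Q *\<^sub>v x) (Q *\<^sub>v x) = scalar_prod (transpose_mat Q *\<^sub>v (Q *\<^sub>v x)) x"
    using Q x by (intro transpose_vec_mult_scalar[symmetric, of _ n n]) auto
  also have "transpose_mat Q *\<^sub>v (Q *\<^sub>v x) = x"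
    using Q x by (subst assoc_mult_mat_vec[symmetric, of _ n n _ n]) auto
  finally have "(euclid_norm (Q *\<^sub>v x))\<^sup>2 = (euclid_norm x)\<^sup>2" by (simp add: euclid_norm_sq)
  then show "euclid_norm (Q *\<^sub>v x) = euclid_norm x" by simp
  have "scalar_prod (transpose_mat Q *\<^sub>v x) (transpose_mat Q *\<^sub>v x) =
      scalar_prod x (Q *\<^sub>v (transpose_mat Q *\<^sub>v x))"
    using Q x by (intro transpose_vec_mult_scalar[of _ n n]) auto
  also have "Q *\<^sub>v (transpose_mat Q *\<^sub>v x) = x"
    using Q x QQ by (subst assoc_mult_mat_vec[symmetric, of _ n n _ n]) auto
  finally have "(euclid_norm (transpose_mat Q *\<^sub>v x))\<^sup>2 = (euclid_norm x)\<^sup>2"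
    by (simp add: euclid_norm_sq)
  then show "euclid_norm (transpose_mat Q *\<^sub>v x) = euclid_norm x" by simp
qed

lemma mult_mat_vec_index_sum:
  "A \<in> carrier_mat m n \<Longrightarrow> v \<in> carrier_vec n \<Longrightarrow> i < m \<Longrightarrow>
    (A *\<^sub>v v) $ i = (\<Sum>j<n. A $$ (i, j) * v $ j)"
  by (simp add: scalar_prod_def lessThan_atLeast0)

lemma euclid_norm_sq_sum: "v \<in> carrier_vec n \<Longrightarrow> (euclid_norm v)\<^sup>2 = (\<Sum>i<n. (v $ i)\<^sup>2)"
  unfolding euclid_norm_def by (subst real_sqrt_pow2) (auto intro!: sum_nonneg)

text \<open>The right half of the decomposition: the columns of Q are right singular vectors, and |A
  x|^2 is read off from the coordinates of x. This suffices, as both perturbation bounds speak only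
  of |A x|. Coordinates count from 0 and singular values from 1, hence \<open>Suc i\<close>.\<close>

lemma singular_value_decomposition:
  fixes A :: "real mat"
  assumes A: "A \<in> carrier_mat m n"
  shows "length (singular_values A) = n"
    and "\<exists>Q \<in> carrier_mat n n. transpose_mat Q * Q = 1\<^sub>m n \<and> (\<forall>x \<in> carrier_vec n.
      (euclid_norm (A *\<^sub>v x))\<^sup>2 =
      (\<Sum>i<n. (sing_val A (Suc i))\<^sup>2 * ((transpose_mat Q *\<^sub>v x) $ i)\<^sup>2))"
    and "set (singular_values A) \<subseteq> {0..}"
proof -
  let ?G = "transpose_mat A * A"
  have G: "?G \<in> carrier_mat n n" "transpose_mat ?G = ?G"
    using A by (auto simp: transpose_mult[of _ n m _ n])
  obtain Q D where Q: "Q \<in> carrier_mat n n" and D: "D \<in> carrier_mat n n" "diagonal_mat D"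
    and QQ: "transpose_mat Q * Q = 1\<^sub>m n" and GQ: "?G = Q * D * transpose_mat Q"
    using spectral_theorem_mat[OF G] by blast
  have QQ': "Q * transpose_mat Q = 1\<^sub>m n"
    using Q QQ mat_mult_left_right_inverse[of "transpose_mat Q" n Q] by simp
  have "similar_mat ?G D"
    by (rule similar_matI[of _ _ Q "transpose_mat Q" n]) (use G Q D QQ QQ' GQ in auto)
  then have "char_poly ?G = (\<Prod>a\<leftarrow>diag_mat D. [:- a, 1:])"
    using char_poly_upper_triangular[OF D(1)] D
    by (simp add: char_poly_similar[of ?G D] diagonal_mat_def upper_triangular_def)
  moreover have "proots (\<Prod>a\<leftarrow>as. [:- a, 1:]) = mset as" for as :: "real list"
  proof (induction as)
    case (Cons a as)
    have "(\<Prod>a\<leftarrow>as. [:- a, 1:]) \<noteq> 0" by (auto simp: prod_list_zero_iff)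
    then show ?case using Cons by (simp add: proots_mult del: mult_pCons_left)
  qed simp
  ultimately have sv: "singular_values A = rev (sort (map sqrt (diag_mat D)))"
    by (simp add: singular_values_def flip: mset_map)
  have lenD: "length (diag_mat D) = n" using D by (simp add: diag_mat_def)
  then show len: "length (singular_values A) = n" by (simp add: sv)
  have norm_A: "(euclid_norm (A *\<^sub>v x))\<^sup>2 = (\<Sum>i<n. D $$ (i, i) * ((transpose_mat Q *\<^sub>v x) $ i)\<^sup>2)"
    if x: "x \<in> carrier_vec n" for x
  proof -
    let ?y = "transpose_mat Q *\<^sub>v x"
    have Dy: "(D *\<^sub>v ?y) $ i = D $$ (i, i) * ?y $ i" if i: "i < n" for i
    proof -
      have "(D *\<^sub>v ?y) $ i = (\<Sum>j<n. D $$ (i, j) * ?y $ j)"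
        using D Q i by (simp add: scalar_prod_def lessThan_atLeast0)
      also have "\<dots> = (\<Sum>j<n. if j = i then D $$ (i, i) * ?y $ i else 0)"
        using D i by (intro sum.cong) (auto simp: diagonal_mat_def)
      finally show ?thesis using i by simp
    qed
    have "(euclid_norm (A *\<^sub>v x))\<^sup>2 = scalar_prod (transpose_mat A *\<^sub>v (A *\<^sub>v x)) x"
      unfolding euclid_norm_sq using A x
      by (intro transpose_vec_mult_scalar[symmetric, of _ m n] mult_mat_vec_carrier[of _ m n]) auto
    also have "transpose_mat A *\<^sub>v (A *\<^sub>v x) = ?G *\<^sub>v x"
      using A x by (subst assoc_mult_mat_vec[of _ n m _ n]) auto
    also have "\<dots> = Q *\<^sub>v (D *\<^sub>v ?y)"
      unfolding GQ using Q D x by (simp add: assoc_mult_mat_vec[of _ n n _ n])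
    also have "scalar_prod \<dots> x = scalar_prod x (Q *\<^sub>v (D *\<^sub>v ?y))"
      using Q D x by (intro comm_scalar_prod[of _ n] mult_mat_vec_carrier[of _ n n]) auto
    also have "\<dots> = scalar_prod ?y (D *\<^sub>v ?y)"
      using Q D x by (intro transpose_vec_mult_scalar[symmetric, of _ n n] mult_mat_vec_carrier[of _ n n]) auto
    also have "\<dots> = (\<Sum>i<n. D $$ (i, i) * (?y $ i)\<^sup>2)"
      using D Q Dy by (auto simp: scalar_prod_def lessThan_atLeast0 power2_eq_square intro!: sum.cong)
    finally show ?thesis .
  qed
  \<comment> \<open>Diagonal entry i is |A Q e_i|^2. Squaring the \<open>sqrt\<close> in
    \<open>singular_values\<close> therefore gives the entry back.\<close>
  have D_nonneg: "D $$ (i, i) \<ge> 0" if i: "i < n" for i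
  proof -
    have "transpose_mat Q *\<^sub>v (Q *\<^sub>v unit_vec n i) = unit_vec n i"
      using Q QQ by (subst assoc_mult_mat_vec[symmetric, of _ n n _ n]) auto
    then have "(euclid_norm (A *\<^sub>v (Q *\<^sub>v unit_vec n i)))\<^sup>2 =
        (\<Sum>j<n. if j = i then D $$ (i, i) else 0)"
      using i Q by (subst norm_A) (auto simp del: sum.delta intro!: sum.cong)
    also have "\<dots> = D $$ (i, i)" using i by simp
    finally show ?thesis by (metis zero_le_power2)
  qed
  then show "set (singular_values A) \<subseteq> {0..}"
    using D by (auto simp: sv diag_mat_def)
  \<comment> \<open>The diagonal of D comes in no particular order; p sorts it, and the columns of Q
    are permuted accordingly.\<close>
  have "mset (singular_values A) = mset (map sqrt (diag_mat D))" by (simp add: sv)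
  from mset_eq_permutation[OF this] obtain p where p: "p permutes {..<n}"
    "permute_list p (map sqrt (diag_mat D)) = singular_values A" by (metis lenD length_map)
  have sD: "(sing_val A (Suc i))\<^sup>2 = D $$ (p i, p i)" if i: "i < n" for i
  proof -
    have pi: "p i < n" using p(1) i by (metis lessThan_iff permutes_in_image)
    have "singular_values A ! i = sqrt (D $$ (p i, p i))"
      unfolding p(2)[symmetric] using p(1) i pi D lenD
      by (subst permute_list_nth) (auto simp: diag_mat_def)
    then show ?thesis using i pi D_nonneg len by (simp add: sing_val_def)
  qed
  define P where "P = mat n n (\<lambda>(i, j). Q $$ (i, p j))"
  have pn: "p i < n" if "i < n" for i using p(1) that by (metis lessThan_iff permutes_in_image)
  have P: "P \<in> carrier_mat n n" by (simp add: P_def)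
  have col: "col P j = col Q (p j)" if "j < n" for j
    using that Q pn by (intro eq_vecI) (auto simp: P_def)
  have "transpose_mat P * P = 1\<^sub>m n"
  proof (intro eq_matI)
    fix i j assume ij: "i < dim_row (1\<^sub>m n :: real mat)" "j < dim_col (1\<^sub>m n :: real mat)"
    have "(transpose_mat P * P) $$ (i, j) = (transpose_mat Q * Q) $$ (p i, p j)"
      using ij P Q pn col by simp
    also have "\<dots> = 1\<^sub>m n $$ (i, j)"
      unfolding QQ using ij pn permutes_inj[OF p(1)] by (auto dest: injD)
    finally show "(transpose_mat P * P) $$ (i, j) = 1\<^sub>m n $$ (i, j)" .
  qed (use P in auto)
  moreover have "(euclid_norm (A *\<^sub>v x))\<^sup>2 =
      (\<Sum>i<n. (sing_val A (Suc i))\<^sup>2 * ((transpose_mat P *\<^sub>v x) $ i)\<^sup>2)" if x: "x \<in> carrier_vec n" for x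
  proof -
    have "(\<Sum>i<n. (sing_val A (Suc i))\<^sup>2 * ((transpose_mat P *\<^sub>v x) $ i)\<^sup>2) =
        (\<Sum>i<n. D $$ (p i, p i) * ((transpose_mat Q *\<^sub>v x) $ p i)\<^sup>2)"
      using P Q pn col by (intro sum.cong) (auto simp: sD)
    also have "\<dots> = (\<Sum>i<n. D $$ (i, i) * ((transpose_mat Q *\<^sub>v x) $ i)\<^sup>2)"
      by (rule sum.reindex_bij_betw[OF permutes_imp_bij[OF p(1)]])
    finally show ?thesis using norm_A[OF x] by simp
  qed
  ultimately show "\<exists>Q \<in> carrier_mat n n. transpose_mat Q * Q = 1\<^sub>m n \<and> (\<forall>x \<in> carrier_vec n.
      (euclid_norm (A *\<^sub>v x))\<^sup>2 =
      (\<Sum>i<n. (sing_val A (Suc i))\<^sup>2 * ((transpose_mat Q *\<^sub>v x) $ i)\<^sup>2))"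
    using P by blast
qed

lemma sing_val_nonneg [simp]: "sing_val A i \<ge> 0"
proof -
  have *: "singular_values A ! j \<ge> 0" if "j < length (singular_values A)" for j
    using singular_value_decomposition(3)[of A "dim_row A" "dim_col A"] that
    by (meson atLeast_iff carrier_matI nth_mem subsetD)
  show ?thesis using *[of "i - 1"] by (auto simp: sing_val_def)
qed

text \<open>Index 0 is excluded because \<open>sing_val A 0\<close> is 0 by convention, possibly
  below \<open>sing_val A 1\<close>. The default 0 beyond the size of the matrix fits the
  order.\<close>

lemma sing_val_decseq:
  assumes "0 < i" "i \<le> j"
  shows "sing_val A j \<le> sing_val A i"
proof (cases "j \<le> length (singular_values A)")
  case True
  have "sorted (rev (singular_values A))" by (simp add: singular_values_def)
  then have "singular_values A ! (j - 1) \<le> singular_values A ! (i - 1)"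
    using True assms by (intro sorted_rev_nth_mono) auto
  then show ?thesis
    using True assms by (simp add: sing_val_def)
next
  case False
  then have "sing_val A j = 0" by (simp add: sing_val_def)
  then show ?thesis by simp
qed

lemma sing_val_beyond: "A \<in> carrier_mat m n \<Longrightarrow> n < i \<Longrightarrow> sing_val A i = 0"
  using singular_value_decomposition(1)[of A m n] by (simp add: sing_val_def)

text \<open>Some combination of the first \<open>i + 1\<close> right singular vectors of \<open>A\<close> is orthogonal to the first
  \<open>i\<close> ones of \<open>B\<close>.\<close>

lemma sing_val_le_add_frob_norm:
  assumes A: "A \<in> carrier_mat m n" and B: "B \<in> carrier_mat m n"
  shows "sing_val A i \<le> sing_val B i + frob_norm (A - B)"
proof (cases "0 < i \<and> i \<le> n")
  case False
  \<comment> \<open>At index 0 and beyond n the left side has its default value.\<close>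
  then have "sing_val A i = 0" using sing_val_beyond[OF A, of i] by (cases "i = 0") (auto simp: sing_val_def)
  then show ?thesis by simp
next
  case True
  then obtain r where r: "i = Suc r" "r < n" by (cases i) auto
  obtain P where P: "P \<in> carrier_mat n n" "transpose_mat P * P = 1\<^sub>m n"
    and PA: "\<And>x. x \<in> carrier_vec n \<Longrightarrow> (euclid_norm (A *\<^sub>v x))\<^sup>2 =
      (\<Sum>i<n. (sing_val A (Suc i))\<^sup>2 * ((transpose_mat P *\<^sub>v x) $ i)\<^sup>2)"
    using singular_value_decomposition(2)[OF A] by blast
  obtain Q where Q: "Q \<in> carrier_mat n n" "transpose_mat Q * Q = 1\<^sub>m n"
    and QB: "\<And>x. x \<in> carrier_vec n \<Longrightarrow> (euclid_norm (B *\<^sub>v x))\<^sup>2 =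
      (\<Sum>i<n. (sing_val B (Suc i))\<^sup>2 * ((transpose_mat Q *\<^sub>v x) $ i)\<^sup>2)"
    using singular_value_decomposition(2)[OF B] by blast
  let ?QP = "transpose_mat Q * P"
  \<comment> \<open>r equations for r + 1 coefficients: the zero row at the bottom makes the system
    square and singular, so a nontrivial solution exists.\<close>
  define E where "E = mat (Suc r) (Suc r) (\<lambda>(l, j). if l < r then ?QP $$ (l, j) else 0)"
  have E: "E \<in> carrier_mat (Suc r) (Suc r)" by (simp add: E_def)
  have "det E = 0"
    using laplace_expansion_row[OF E, of r] by (simp add: E_def)
  then obtain c' where c': "c' \<in> carrier_vec (Suc r)" "c' \<noteq> 0\<^sub>v (Suc r)" "E *\<^sub>v c' = 0\<^sub>v (Suc r)"
    using det_0_iff_vec_prod_zero[OF E] by blast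
  define c where "c = vec n (\<lambda>j. if j \<le> r then c' $ j else 0)"
  define x where "x = P *\<^sub>v c"
  have c: "c \<in> carrier_vec n" and x: "x \<in> carrier_vec n" using P by (auto simp: c_def x_def)
  have "c \<noteq> 0\<^sub>v n"
  proof
    assume 0: "c = 0\<^sub>v n"
    have "c' $ j = 0" if "j < Suc r" for j
      using arg_cong[OF 0, of "\<lambda>v. v $ j"] that r by (simp add: c_def)
    then show False using c' by (metis carrier_vecD eq_vecI index_zero_vec)
  qed
  then obtain j where "j < n" "c $ j \<noteq> 0" using c by (metis carrier_vecD eq_vecI index_zero_vec)
  then have "(euclid_norm c)\<^sup>2 > 0"
    unfolding euclid_norm_sq_sum[OF c] by (intro sum_pos2[of _ j]) auto
  then have c_pos: "euclid_norm c > 0"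
    by (metis euclid_norm_nonneg less_le power_zero_numeral)
  have xc: "euclid_norm x = euclid_norm c"
    unfolding x_def by (rule orthogonal_mat_euclid_norm(1)[OF P c])
  have Px: "transpose_mat P *\<^sub>v x = c"
    unfolding x_def using P c by (subst assoc_mult_mat_vec[symmetric, of _ n n _ n]) auto
  have Qx: "(transpose_mat Q *\<^sub>v x) $ l = 0" if l: "l < r" for l
  proof -
    have "transpose_mat Q *\<^sub>v x = ?QP *\<^sub>v c"
      unfolding x_def using P Q c by (subst assoc_mult_mat_vec[of _ n n _ n]) auto
    then have "(transpose_mat Q *\<^sub>v x) $ l = (\<Sum>j<n. ?QP $$ (l, j) * c $ j)"
      using P Q c l r by (simp only:) (intro mult_mat_vec_index_sum[of _ n], auto)
    also have "\<dots> = (\<Sum>j<Suc r. ?QP $$ (l, j) * c $ j)"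
      using r by (intro sum.mono_neutral_right) (auto simp: c_def)
    also have "\<dots> = (\<Sum>j<Suc r. E $$ (l, j) * c' $ j)"
      using r l by (intro sum.cong) (auto simp: c_def E_def)
    also have "\<dots> = (E *\<^sub>v c') $ l"
      using E c' l by (intro mult_mat_vec_index_sum[symmetric, of _ "Suc r"]) auto
    finally show ?thesis using c' l by simp
  qed
  \<comment> \<open>x is spanned by the first i right singular vectors of A, so A stretches it by at
    least \<open>sing_val A i\<close>.\<close>
  have "(sing_val A i * euclid_norm x)\<^sup>2 = (\<Sum>j<n. (sing_val A i)\<^sup>2 * (c $ j)\<^sup>2)"
    by (simp add: power_mult_distrib xc euclid_norm_sq_sum[OF c] sum_distrib_left)
  also have "\<dots> \<le> (\<Sum>j<n. (sing_val A (Suc j))\<^sup>2 * (c $ j)\<^sup>2)"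
  proof (intro sum_mono)
    fix j assume "j \<in> {..<n}"
    then show "(sing_val A i)\<^sup>2 * (c $ j)\<^sup>2 \<le> (sing_val A (Suc j))\<^sup>2 * (c $ j)\<^sup>2"
      by (cases "j \<le> r") (auto simp: c_def r intro!: mult_right_mono power_mono sing_val_decseq)
  qed
  also have "\<dots> = (euclid_norm (A *\<^sub>v x))\<^sup>2" by (simp add: PA[OF x] Px)
  finally have "sing_val A i * euclid_norm x \<le> euclid_norm (A *\<^sub>v x)"
    by (rule power2_le_imp_le) simp
  also have "\<dots> \<le> euclid_norm (B *\<^sub>v x) + euclid_norm ((A - B) *\<^sub>v x)"
    unfolding mult_vec_split_diff[OF A B x] using A B x
    by (intro euclid_norm_triangle[of _ m] mult_mat_vec_carrier[of _ m n] minus_carrier_mat) auto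
  also have "euclid_norm ((A - B) *\<^sub>v x) \<le> frob_norm (A - B) * euclid_norm x"
    using A B x by (intro euclid_norm_mult_vec_le[of _ m n] minus_carrier_mat) auto
  \<comment> \<open>The coordinates of x along the first r = i - 1 right singular vectors of B
    vanish, so the largest singular value of B acting on x is number i.\<close>
  also have "euclid_norm (B *\<^sub>v x) \<le> sing_val B i * euclid_norm x"
  proof (rule power2_le_imp_le)
    have "(euclid_norm (B *\<^sub>v x))\<^sup>2 \<le> (\<Sum>j<n. (sing_val B i)\<^sup>2 * ((transpose_mat Q *\<^sub>v x) $ j)\<^sup>2)"
      unfolding QB[OF x]
    proof (intro sum_mono)
      fix j assume "j \<in> {..<n}"
      then show "(sing_val B (Suc j))\<^sup>2 * ((transpose_mat Q *\<^sub>v x) $ j)\<^sup>2 \<le>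
          (sing_val B i)\<^sup>2 * ((transpose_mat Q *\<^sub>v x) $ j)\<^sup>2"
        using Qx[of j] by (cases "j < r") (auto simp: r intro!: mult_right_mono power_mono sing_val_decseq)
    qed
    also have "\<dots> = (sing_val B i * euclid_norm x)\<^sup>2"
      using euclid_norm_sq_sum[of "transpose_mat Q *\<^sub>v x" n] Q x
        orthogonal_mat_euclid_norm(2)[OF Q x]
      by (simp add: power_mult_distrib flip: sum_distrib_left)
    finally show "(euclid_norm (B *\<^sub>v x))\<^sup>2 \<le> (sing_val B i * euclid_norm x)\<^sup>2" .
  qed simp
  finally have "sing_val A i * euclid_norm x \<le> (sing_val B i + frob_norm (A - B)) * euclid_norm x"
    by (simp add: algebra_simps)
  then show ?thesis using c_pos xc by simp
qed

lemma frob_norm_minus_commute: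
  assumes "A \<in> carrier_mat m n" "B \<in> carrier_mat m n"
  shows "frob_norm (A - B) = frob_norm (B - A)"
proof -
  have "(A - B) $$ (i, j) * (A - B) $$ (i, j) = (B - A) $$ (i, j) * (B - A) $$ (i, j)"
    if "i < m" "j < n" for i j
    using assms that by (simp add: left_diff_distrib right_diff_distrib)
  then have "frob_inner (A - B) (A - B) = frob_inner (B - A) (B - A)"
    unfolding frob_inner_def using assms by (intro sum.cong) auto
  then show ?thesis by (simp add: frob_norm_def)
qed

lemma sing_val_lipschitz:
  assumes A: "A \<in> carrier_mat m n" and B: "B \<in> carrier_mat m n"
  shows "\<bar>sing_val A i - sing_val B i\<bar> \<le> frob_norm (A - B)"
  using sing_val_le_add_frob_norm[OF A B, of i] sing_val_le_add_frob_norm[OF B A, of i]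
    frob_norm_minus_commute[OF A B] by linarith

section \<open>Tail sums of squared singular values\<close>

lemma mult_mat_unit_vec:
  fixes A :: "'a :: comm_ring_1 mat"
  shows "A \<in> carrier_mat m n \<Longrightarrow> j < n \<Longrightarrow> A *\<^sub>v unit_vec n j = col A j"
  by (intro eq_vecI) (auto simp: scalar_prod_right_unit)

text \<open>A nonincreasing sequence is weighted least when all the mass sits at the end. The
  factors \<open>a i - a k\<close> and \<open>w i - of_bool (k \<le> i)\<close> never have opposite
  signs, and since both weights have the same total, subtracting the constant \<open>a k\<close>
  changes nothing.\<close>

lemma tail_sum_le_weighted_sum:
  fixes a w :: "nat \<Rightarrow> real"
  assumes k: "k < n"
    and a: "\<And>i j. i \<le> j \<Longrightarrow> a j \<le> a i"
    and w: "\<And>i. i < n \<Longrightarrow> 0 \<le> w i" "\<And>i. i < n \<Longrightarrow> w i \<le> 1" "(\<Sum>i<n. w i) = real (n - k)"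
  shows "(\<Sum>i\<in>{k..<n}. a i) \<le> (\<Sum>i<n. a i * w i)"
proof -
  have tail: "(\<Sum>i<n. b i * of_bool (k \<le> i)) = (\<Sum>i\<in>{k..<n}. b i)" for b :: "nat \<Rightarrow> real"
    by (intro sum.mono_neutral_cong_right) auto
  have "0 = (\<Sum>i<n. a k * w i) - (\<Sum>i<n. a k * of_bool (k \<le> i))"
    unfolding tail[of "\<lambda>_. a k"] unfolding sum_distrib_left[symmetric] w(3) by simp
  also have "\<dots> = (\<Sum>i<n. a k * (w i - of_bool (k \<le> i)))"
    by (simp add: right_diff_distrib sum_subtractf)
  also have "\<dots> \<le> (\<Sum>i<n. a i * (w i - of_bool (k \<le> i)))"
  proof (intro sum_mono)
    fix i assume i: "i \<in> {..<n}"
    show "a k * (w i - of_bool (k \<le> i)) \<le> a i * (w i - of_bool (k \<le> i))"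
    proof (cases "k \<le> i")
      case True
      then show ?thesis using a[of k i] w(2)[of i] i by (intro mult_right_mono_neg) auto
    next
      case False
      then show ?thesis using a[of i k] w(1)[of i] i by (intro mult_right_mono) auto
    qed
  qed
  also have "\<dots> = (\<Sum>i<n. a i * w i) - (\<Sum>i\<in>{k..<n}. a i)"
    by (simp add: right_diff_distrib sum_subtractf tail)
  finally show ?thesis by simp
qed

text \<open>Ky Fan: the trailing right singular vectors of \<open>B\<close> are an orthonormal test family for \<open>A\<close>, and
  the trailing singular values of \<open>A\<close> minimise \<open>\<Sum> \<parallel>A y\<parallel>\<^sup>2\<close> among such families.\<close>

lemma sum_tail_sing_val_le:
  assumes A: "A \<in> carrier_mat m n" and B: "B \<in> carrier_mat m n"
  shows "(\<Sum>i\<in>{k<..n}. (sing_val A i)\<^sup>2) \<le>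
    2 * (\<Sum>i\<in>{k<..n}. (sing_val B i)\<^sup>2) + 2 * (frob_norm (A - B))\<^sup>2"
proof (cases "k < n")
  case False
  then show ?thesis by simp
next
  case True
  obtain P where P: "P \<in> carrier_mat n n" "transpose_mat P * P = 1\<^sub>m n"
    and PA: "\<And>x. x \<in> carrier_vec n \<Longrightarrow> (euclid_norm (A *\<^sub>v x))\<^sup>2 =
      (\<Sum>i<n. (sing_val A (Suc i))\<^sup>2 * ((transpose_mat P *\<^sub>v x) $ i)\<^sup>2)"
    using singular_value_decomposition(2)[OF A] by blast
  obtain Q where Q: "Q \<in> carrier_mat n n" "transpose_mat Q * Q = 1\<^sub>m n"
    and QB: "\<And>x. x \<in> carrier_vec n \<Longrightarrow> (euclid_norm (B *\<^sub>v x))\<^sup>2 =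
      (\<Sum>i<n. (sing_val B (Suc i))\<^sup>2 * ((transpose_mat Q *\<^sub>v x) $ i)\<^sup>2)"
    using singular_value_decomposition(2)[OF B] by blast
  define y where "y l = Q *\<^sub>v unit_vec n l" for l
  have y: "y l \<in> carrier_vec n" for l using Q by (simp add: y_def)
  have D: "A - B \<in> carrier_mat m n" using B by (rule minus_carrier_mat)
  have unit: "euclid_norm (unit_vec n l) = 1" if "l < n" for l
  proof -
    have "(euclid_norm (unit_vec n l))\<^sup>2 = 1\<^sup>2" using that by (simp add: euclid_norm_sq)
    then show ?thesis by (rule power2_eq_imp_eq) auto
  qed
  \<comment> \<open>The numbers \<open>p l i\<close> are the entries of the orthogonal matrix Q^T P,
    so their squares are doubly stochastic: row sums give w the total n - k, and column sums bound
    each \<open>w i\<close> by 1.\<close>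
  define p where "p l i = (transpose_mat P *\<^sub>v y l) $ i" for l i
  define w where "w i = (\<Sum>l\<in>{k..<n}. (p l i)\<^sup>2)" for i
  have p_row: "(\<Sum>i<n. (p l i)\<^sup>2) = 1" if "l < n" for l
    using orthogonal_mat_euclid_norm[OF P y, of l] orthogonal_mat_euclid_norm[OF Q, of "unit_vec n l"] that P Q
      unit[OF that] euclid_norm_sq_sum[of "transpose_mat P *\<^sub>v y l" n]
    by (simp add: p_def y_def)
  have p_swap: "p l i = (transpose_mat Q *\<^sub>v (P *\<^sub>v unit_vec n i)) $ l" if "i < n" "l < n" for l i
  proof -
    have "p l i = col P i \<bullet> col Q l"
      using that P Q by (simp add: p_def y_def mult_mat_unit_vec)
    also have "\<dots> = col Q l \<bullet> col P i" using P Q by (intro comm_scalar_prod[of _ n]) auto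
    finally show ?thesis using that P Q by (simp add: mult_mat_unit_vec)
  qed
  have p_col: "(\<Sum>l<n. (p l i)\<^sup>2) = 1" if i: "i < n" for i
  proof -
    have Pe: "P *\<^sub>v unit_vec n i \<in> carrier_vec n" using P by simp
    have "(\<Sum>l<n. (p l i)\<^sup>2) = (euclid_norm (transpose_mat Q *\<^sub>v (P *\<^sub>v unit_vec n i)))\<^sup>2"
      using Q Pe i by (subst euclid_norm_sq_sum[of _ n]) (auto simp: p_swap)
    also have "\<dots> = 1"
      using orthogonal_mat_euclid_norm(2)[OF Q Pe] orthogonal_mat_euclid_norm(1)[OF P, of "unit_vec n i"] i
      by (simp add: unit)
    finally show ?thesis .
  qed
  have w: "0 \<le> w i" "w i \<le> 1" if "i < n" for i
  proof -
    show "0 \<le> w i" by (simp add: w_def sum_nonneg)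
    have "w i \<le> (\<Sum>l<n. (p l i)\<^sup>2)" unfolding w_def by (intro sum_mono2) auto
    then show "w i \<le> 1" using p_col that by simp
  qed
  have w_sum: "(\<Sum>i<n. w i) = real (n - k)"
    unfolding w_def by (subst sum.swap) (simp add: p_row)
  have shift: "(\<Sum>i\<in>{k<..n}. (sing_val X i)\<^sup>2) = (\<Sum>i\<in>{k..<n}. (sing_val X (Suc i))\<^sup>2)" for X
    by (rule sum.reindex_bij_witness[of _ Suc "\<lambda>i. i - 1"]) auto
  have "(\<Sum>i\<in>{k<..n}. (sing_val A i)\<^sup>2) \<le> (\<Sum>i<n. (sing_val A (Suc i))\<^sup>2 * w i)"
    unfolding shift using True w w_sum
    by (intro tail_sum_le_weighted_sum) (auto intro!: power_mono sing_val_decseq)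
  also have "\<dots> = (\<Sum>l\<in>{k..<n}. (euclid_norm (A *\<^sub>v y l))\<^sup>2)"
    unfolding w_def sum_distrib_left by (subst sum.swap) (simp add: PA[OF y] p_def)
  also have "\<dots> \<le> (\<Sum>l\<in>{k..<n}. 2 * (sing_val B (Suc l))\<^sup>2 + 2 * (euclid_norm ((A - B) *\<^sub>v y l))\<^sup>2)"
  proof (intro sum_mono)
    fix l assume l: "l \<in> {k..<n}"
    have "transpose_mat Q *\<^sub>v y l = unit_vec n l"
      unfolding y_def using Q by (subst assoc_mult_mat_vec[symmetric, of _ n n _ n]) auto
    then have "(euclid_norm (B *\<^sub>v y l))\<^sup>2 = (\<Sum>i<n. if i = l then (sing_val B (Suc l))\<^sup>2 else 0)"
      using l by (subst QB[OF y]) (auto simp del: sum.delta intro!: sum.cong)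
    then have By: "(euclid_norm (B *\<^sub>v y l))\<^sup>2 = (sing_val B (Suc l))\<^sup>2" using l by simp
    have "euclid_norm (A *\<^sub>v y l) \<le> euclid_norm (B *\<^sub>v y l) + euclid_norm ((A - B) *\<^sub>v y l)"
      unfolding mult_vec_split_diff[OF A B y] using B y D
      by (intro euclid_norm_triangle[of _ m] mult_mat_vec_carrier[of _ m n]) auto
    then have "(euclid_norm (A *\<^sub>v y l))\<^sup>2 \<le>
        (euclid_norm (B *\<^sub>v y l) + euclid_norm ((A - B) *\<^sub>v y l))\<^sup>2"
      by (intro power_mono) auto
    \<comment> \<open>The mixed term is split by 2 a b \<le> a^2 + b^2; both factors 2 of the claim
      come from here.\<close>
    also have "\<dots> \<le> 2 * (euclid_norm (B *\<^sub>v y l))\<^sup>2 + 2 * (euclid_norm ((A - B) *\<^sub>v y l))\<^sup>2"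
      using sum_squares_bound[of "euclid_norm (B *\<^sub>v y l)" "euclid_norm ((A - B) *\<^sub>v y l)"]
      by (simp add: power2_sum)
    finally show "(euclid_norm (A *\<^sub>v y l))\<^sup>2 \<le>
        2 * (sing_val B (Suc l))\<^sup>2 + 2 * (euclid_norm ((A - B) *\<^sub>v y l))\<^sup>2" by (simp add: By)
  qed
  also have "\<dots> = 2 * (\<Sum>i\<in>{k<..n}. (sing_val B i)\<^sup>2) +
      2 * (\<Sum>l\<in>{k..<n}. (euclid_norm ((A - B) *\<^sub>v y l))\<^sup>2)"
    by (simp add: shift sum.distrib sum_distrib_left)
  \<comment> \<open>Enlarging the tail to the whole orthonormal basis makes Parseval's identity
    applicable to each row of A - B.\<close>
  also have "(\<Sum>l\<in>{k..<n}. (euclid_norm ((A - B) *\<^sub>v y l))\<^sup>2) \<le>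
      (\<Sum>l<n. (euclid_norm ((A - B) *\<^sub>v y l))\<^sup>2)"
    by (intro sum_mono2) auto
  also have "\<dots> = (\<Sum>l<n. \<Sum>i<m. (row (A - B) i \<bullet> y l)\<^sup>2)"
    using D y by (intro sum.cong refl, subst euclid_norm_sq_sum[of _ m]) auto
  also have "\<dots> = (\<Sum>i<m. \<Sum>l<n. (row (A - B) i \<bullet> y l)\<^sup>2)" by (rule sum.swap)
  also have "\<dots> = (\<Sum>i<m. (euclid_norm (transpose_mat Q *\<^sub>v row (A - B) i))\<^sup>2)"
  proof (intro sum.cong refl)
    fix i assume i: "i \<in> {..<m}"
    have r: "row (A - B) i \<in> carrier_vec n" by (rule carrier_vecI) (use D in \<open>simp only: index_row carrier_matD\<close>)
    have "(row (A - B) i \<bullet> y l) = (transpose_mat Q *\<^sub>v row (A - B) i) $ l" if "l < n" for l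
    proof -
      have "row (A - B) i \<bullet> y l = (transpose_mat Q *\<^sub>v row (A - B) i) \<bullet> unit_vec n l"
        unfolding y_def using Q r by (intro transpose_vec_mult_scalar[symmetric, of _ n n]) auto
      then show ?thesis using that Q r by (simp add: scalar_prod_right_unit del: index_mult_mat_vec)
    qed
    then show "(\<Sum>l<n. (row (A - B) i \<bullet> y l)\<^sup>2) = (euclid_norm (transpose_mat Q *\<^sub>v row (A - B) i))\<^sup>2"
      using Q r by (subst euclid_norm_sq_sum[of _ n]) auto
  qed
  also have "\<dots> = (\<Sum>i<m. (euclid_norm (row (A - B) i))\<^sup>2)"
    using D by (intro sum.cong refl, subst orthogonal_mat_euclid_norm(2)[OF Q]) auto
  also have "\<dots> = (frob_norm (A - B))\<^sup>2" by (simp only: frob_norm_sq_rows carrier_matD(1)[OF D])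
  finally show ?thesis by simp
qed

section \<open>Measurability of functions of a random matrix\<close>

lemma frob_norm_le_sum_abs:
  "X \<in> carrier_mat m n \<Longrightarrow> frob_norm X \<le> (\<Sum>i<m. \<Sum>j<n. \<bar>X $$ (i, j)\<bar>)"
  using L2_set_le_sum_abs[of "\<lambda>p. X $$ p" "{..<m} \<times> {..<n}"]
  by (simp add: frob_norm_def frob_inner_def L2_set_def sum.cartesian_product power2_eq_square case_prod_beta')

text \<open>The approximants are indexed by \<open>rat list\<close>, a countable type, so that a
  union over all of them stays measurable.\<close>

lemma rat_mat_dense:
  fixes X :: "real mat"
  assumes X: "X \<in> carrier_mat m n" and e: "e > 0"
  obtains q :: "rat list" where
    "frob_norm (X - mat m n (\<lambda>(i, j). of_rat (q ! (i * n + j)))) < e"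
proof -
  \<comment> \<open>Each of the m n entries may be off by \<delta>. The summand 1 makes the total
    strictly less than e and covers empty matrices.\<close>
  define \<delta> where "\<delta> = e / (real m * real n + 1)"
  have \<delta>: "\<delta> > 0" "real m * real n * \<delta> < e"
  proof -
    have "real m * real n + 1 > 0" by (simp add: add_nonneg_pos)
    then show "\<delta> > 0" "real m * real n * \<delta> < e" using e by (auto simp: \<delta>_def field_simps)
  qed
  have "\<exists>r. \<bar>x - of_rat r\<bar> < \<delta>" for x :: real
  proof -
    obtain r where "x - \<delta> < of_rat r" "of_rat r < x + \<delta>"
      using of_rat_dense[of "x - \<delta>" "x + \<delta>"] \<delta> by auto
    then show ?thesis by (intro exI[of _ r]) (simp add: abs_less_iff)
  qed
  then obtain r where r: "\<And>x::real. \<bar>x - of_rat (r x)\<bar> < \<delta>" by metis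
  \<comment> \<open>Row-major order: entry (i, j) sits at position i n + j.\<close>
  define q where "q = map (\<lambda>t. r (X $$ (t div n, t mod n))) [0..<m * n]"
  have q: "q ! (i * n + j) = r (X $$ (i, j))" if "i < m" "j < n" for i j
  proof -
    have "i * n + j < Suc i * n" using that by simp
    also have "\<dots> \<le> m * n" using that by (intro mult_right_mono) auto
    finally show ?thesis using that by (simp add: q_def)
  qed
  let ?Y = "mat m n (\<lambda>(i, j). of_rat (q ! (i * n + j))) :: real mat"
  have "frob_norm (X - ?Y) \<le> (\<Sum>i<m. \<Sum>j<n. \<bar>(X - ?Y) $$ (i, j)\<bar>)"
    using X by (intro frob_norm_le_sum_abs minus_carrier_mat) auto
  also have "\<dots> \<le> (\<Sum>i<m. \<Sum>j<n. \<delta>)"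
    using X r by (intro sum_mono) (auto simp: q less_imp_le)
  also have "\<dots> < e" using \<delta> by (simp add: mult.assoc)
  finally show thesis by (rule that)
qed

lemma borel_measurable_frob_norm_diff:
  assumes A: "random_mat M m n A" and B: "B \<in> carrier_mat m n"
  shows "(\<lambda>\<omega>. frob_norm (A \<omega> - B)) \<in> borel_measurable M"
proof -
  have [measurable]: "(\<lambda>\<omega>. A \<omega> $$ (i, j)) \<in> borel_measurable M" if "i < m" "j < n" for i j
    using A that by (simp add: random_mat_def)
  have "(\<lambda>\<omega>. sqrt (\<Sum>i<m. \<Sum>j<n. (A \<omega> $$ (i, j) - B $$ (i, j))\<^sup>2)) \<in> borel_measurable M"
    by (intro measurable_compose[OF _ borel_measurable_sqrt] borel_measurable_sum
        borel_measurable_power borel_measurable_diff) auto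
  moreover have "frob_norm (A \<omega> - B) = sqrt (\<Sum>i<m. \<Sum>j<n. (A \<omega> $$ (i, j) - B $$ (i, j))\<^sup>2)"
    if "\<omega> \<in> space M" for \<omega>
  proof -
    have "A \<omega> \<in> carrier_mat m n" using A that by (auto simp: random_mat_def)
    then show ?thesis using B by (simp add: frob_norm_def frob_inner_def power2_eq_square)
  qed
  ultimately show ?thesis by (simp cong: measurable_cong)
qed

text \<open>That f lies below c at \<open>A \<omega>\<close> can be certified by a nearby rational
  matrix, and these are countably many. As X and Y may be exchanged, the one-sided hypothesis gives
  both directions.\<close>

lemma borel_measurable_frob_lipschitz:
  assumes A: "random_mat M m n A"
    and f: "\<And>X Y. X \<in> carrier_mat m n \<Longrightarrow> Y \<in> carrier_mat m n \<Longrightarrow> f X \<le> f Y + frob_norm (X - Y)"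
  shows "(\<lambda>\<omega>. f (A \<omega>)) \<in> borel_measurable M"
proof (rule borel_measurableI_less)
  fix c :: real
  define B where "B q = mat m n (\<lambda>(i, j). of_rat (q ! (i * n + j)) :: real)" for q :: "rat list"
  have B: "B q \<in> carrier_mat m n" for q by (simp add: B_def)
  have Ac: "A \<omega> \<in> carrier_mat m n" if "\<omega> \<in> space M" for \<omega>
    using A that by (auto simp: random_mat_def)
  have "{\<omega> \<in> space M. f (A \<omega>) < c} = (\<Union>q. {\<omega> \<in> space M. f (B q) + frob_norm (A \<omega> - B q) < c})"
  proof (intro equalityI subsetI)
    fix \<omega> assume "\<omega> \<in> {\<omega> \<in> space M. f (A \<omega>) < c}"
    then have \<omega>: "\<omega> \<in> space M" "f (A \<omega>) < c" by auto
    \<comment> \<open>Half of the gap, because the distance to \<open>B q\<close> is paid twice: in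
      estimating \<open>f (B q)\<close> and in the certificate itself.\<close>
    obtain q where "frob_norm (A \<omega> - B q) < (c - f (A \<omega>)) / 2"
      using rat_mat_dense[OF Ac[OF \<omega>(1)], of "(c - f (A \<omega>)) / 2"] \<omega>(2) unfolding B_def by auto
    moreover have "f (B q) \<le> f (A \<omega>) + frob_norm (A \<omega> - B q)"
      using f[OF B Ac[OF \<omega>(1)], of q] frob_norm_minus_commute[OF B Ac[OF \<omega>(1)], of q] by simp
    ultimately show "\<omega> \<in> (\<Union>q. {\<omega> \<in> space M. f (B q) + frob_norm (A \<omega> - B q) < c})"
      using \<omega> by (auto intro!: exI[of _ q])
  next
    fix \<omega> assume "\<omega> \<in> (\<Union>q. {\<omega> \<in> space M. f (B q) + frob_norm (A \<omega> - B q) < c})"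
    then obtain q where "\<omega> \<in> space M" "f (B q) + frob_norm (A \<omega> - B q) < c" by auto
    then show "\<omega> \<in> {\<omega> \<in> space M. f (A \<omega>) < c}" using f[OF Ac B, of \<omega> q] by auto
  qed
  also have "\<dots> \<in> sets M"
  proof (intro sets.countable_UN subsetI)
    fix X assume "X \<in> range (\<lambda>q. {\<omega> \<in> space M. f (B q) + frob_norm (A \<omega> - B q) < c})"
    then obtain q where X: "X = {\<omega> \<in> space M. f (B q) + frob_norm (A \<omega> - B q) < c}" by blast
    have [measurable]: "(\<lambda>\<omega>. frob_norm (A \<omega> - B q)) \<in> borel_measurable M"
      by (rule borel_measurable_frob_norm_diff[OF A B])
    show "X \<in> sets M" unfolding X by measurable
  qed
  finally show "{\<omega> \<in> space M. f (A \<omega>) < c} \<in> sets M" .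
qed

lemma borel_measurable_sing_val:
  "random_mat M m n A \<Longrightarrow> (\<lambda>\<omega>. sing_val (A \<omega>) i) \<in> borel_measurable M"
  by (erule borel_measurable_frob_lipschitz) (rule sing_val_le_add_frob_norm)

lemma borel_measurable_op_norm:
  "random_mat M m n A \<Longrightarrow> (\<lambda>\<omega>. op_norm (A \<omega>)) \<in> borel_measurable M"
  by (erule borel_measurable_frob_lipschitz) (rule op_norm_lipschitz)

section \<open>Maximum norm, softmax and scaled layers\<close>

lemma abs_vec_index_le_max_norm: "i < dim_vec v \<Longrightarrow> \<bar>v $ i\<bar> \<le> max_norm v"
  unfolding max_norm_def by (intro Max_ge) auto

lemma max_norm_nonneg [simp]: "max_norm v \<ge> 0"
  unfolding max_norm_def by (intro Max_ge) auto

lemma max_norm_leI: "0 \<le> c \<Longrightarrow> (\<And>i. i < dim_vec v \<Longrightarrow> \<bar>v $ i\<bar> \<le> c) \<Longrightarrow> max_norm v \<le> c"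
  unfolding max_norm_def by (intro Max.boundedI) auto

lemma max_norm_diff_pos:
  assumes "v \<in> carrier_vec n" "w \<in> carrier_vec n" "v \<noteq> w"
  shows "max_norm (v - w) > 0"
proof -
  obtain i where "i < n" "v $ i \<noteq> w $ i" using assms by (metis carrier_vecD eq_vecI)
  then show ?thesis using abs_vec_index_le_max_norm[of i "v - w"] assms by auto
qed

text \<open>Finiteness matters, as \<open>enn2real\<close> would send an infinite constant to 0.
  Equal points lie outside the supremum and are treated apart.\<close>

lemma max_norm_diff_le_lip_const:
  assumes U: "U \<subseteq> carrier_vec n" and vw: "v \<in> U" "w \<in> U" and fin: "lip_const f U < \<infinity>"
    and f: "f w \<in> carrier_vec m"
  shows "max_norm (f v - f w) \<le> enn2real (lip_const f U) * max_norm (v - w)"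
proof (cases "v = w")
  case True
  have "max_norm (f w - f w) \<le> 0" using f by (intro max_norm_leI) auto
  then show ?thesis using True by (simp add: order_trans[OF _ mult_nonneg_nonneg])
next
  case False
  have pos: "max_norm (v - w) > 0" using U vw False by (intro max_norm_diff_pos[of _ n]) auto
  have "ennreal (max_norm (f v - f w) / max_norm (v - w)) \<le> lip_const f U"
    unfolding lip_const_def using vw False by (intro SUP_upper2[of "(v, w)"]) auto
  then have "enn2real (ennreal (max_norm (f v - f w) / max_norm (v - w))) \<le> enn2real (lip_const f U)"
    using fin by (intro enn2real_mono) auto
  then show ?thesis using pos by (simp add: pos_divide_le_eq)
qed

text \<open>The logarithm of softmax is a coordinate minus log-sum-exp. Each of the two is
  1-Lipschitz for the maximum norm, hence the factor 2.\<close>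

lemma ln_softmax_diff_le:
  assumes v: "v \<in> carrier_vec K" and w: "w \<in> carrier_vec K" and c: "c < K"
    and a: "max_norm (v - w) \<le> a"
  shows "ln (softmax w $ c) - ln (softmax v $ c) \<le> 2 * a"
proof -
  have d: "\<bar>v $ i - w $ i\<bar> \<le> a" if "i < K" for i
    using abs_vec_index_le_max_norm[of i "v - w"] that v w a by simp
  define V where "V = (\<Sum>j<K. exp (v $ j))"
  define Z where "Z = (\<Sum>j<K. exp (w $ j))"
  have pos: "V > 0" "Z > 0" using c by (auto simp: V_def Z_def intro!: sum_pos)
  have "V \<le> (\<Sum>j<K. exp a * exp (w $ j))"
    unfolding V_def by (intro sum_mono) (use d in \<open>fastforce simp flip: exp_add\<close>)
  also have "\<dots> = exp a * Z" by (simp add: Z_def sum_distrib_left)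
  finally have "ln V \<le> ln (exp a * Z)" using pos by (subst ln_le_cancel_iff) auto
  also have "\<dots> = a + ln Z" using pos by (subst ln_mult) auto
  finally have VZ: "ln V \<le> a + ln Z" .
  have "ln (softmax v $ c) = v $ c - ln V" "ln (softmax w $ c) = w $ c - ln Z"
    using pos c v w by (simp_all add: softmax_def V_def Z_def ln_div)
  then show ?thesis using VZ d[OF c] by simp
qed

lemma scaled_layer_mult_vec:
  assumes "A \<in> carrier_mat n n" "B \<in> carrier_mat n n" "x \<in> carrier_vec n"
  shows "scaled_layer A B \<theta> *\<^sub>v x = A *\<^sub>v x + \<theta> \<cdot>\<^sub>v (B *\<^sub>v x)"
  using assms unfolding scaled_layer_def
  by (intro eq_vecI)
    (auto simp: scalar_prod_def distrib_right sum.distrib sum_distrib_left mult.assoc)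

lemma frob_norm_scaled_layer_sq:
  assumes "A \<in> carrier_mat n n" "B \<in> carrier_mat n n"
  shows "(frob_norm (scaled_layer A B \<theta>))\<^sup>2 =
    (frob_norm A)\<^sup>2 + 2 * \<theta> * frob_inner A B + \<theta>\<^sup>2 * (frob_norm B)\<^sup>2"
proof -
  have "frob_inner (scaled_layer A B \<theta>) (scaled_layer A B \<theta>) =
      (\<Sum>i<n. \<Sum>j<n. A $$ (i, j) * A $$ (i, j) + 2 * \<theta> * (A $$ (i, j) * B $$ (i, j)) +
        \<theta>\<^sup>2 * (B $$ (i, j) * B $$ (i, j)))"
    unfolding frob_inner_def scaled_layer_def using assms
    by (intro sum.cong) (auto simp: algebra_simps power2_eq_square)
  then show ?thesis
    using assms by (simp add: frob_norm_sq frob_inner_def sum.distrib sum_distrib_left)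
qed

lemma conv_probD:
  "conv_prob M Y c F \<Longrightarrow> e > 0 \<Longrightarrow>
    ((\<lambda>i. measure (M i) {\<omega> \<in> space (M i). \<bar>Y i \<omega> - c\<bar> > e}) \<longlongrightarrow> 0) F"
  by (simp add: conv_prob_def)

section \<open>Convergence in probability\<close>

lemma tendsto_0_measure_le:
  assumes "\<forall>\<^sub>F i in F. measure (M i) (A i) \<le> f i" and "(f \<longlongrightarrow> 0) F"
  shows "((\<lambda>i. measure (M i) (A i)) \<longlongrightarrow> 0) F"
  by (rule tendsto_sandwich[OF _ assms(1) tendsto_const assms(2)]) simp

text \<open>The bound may fail off events whose probability tends to 1, as with minimality and the
  conditional tail bound, and on null sets, as with the factorization and the Lipschitz
  condition.\<close>

lemma conv_prob_dominated:
  assumes M: "\<forall>\<^sub>F i in F. prob_space (M i)"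
    and Y: "\<forall>\<^sub>F i in F. Y i \<in> borel_measurable (M i)"
    and G: "((\<lambda>i. measure (M i) (G i)) \<longlongrightarrow> 1) F"
    and le: "\<forall>\<^sub>F i in F. AE \<omega> in M i. \<omega> \<in> G i \<longrightarrow> \<bar>Y i \<omega>\<bar> \<le> \<bar>Z i \<omega>\<bar>"
    and Z: "conv_prob M Z 0 F"
  shows "conv_prob M Y 0 F"
  unfolding conv_prob_def
proof (intro conjI allI impI Y)
  fix e :: real assume e: "e > 0"
  have "\<forall>\<^sub>F i in F. measure (M i) (G i) > 0" using G by (rule order_tendstoD) simp
  then have "\<forall>\<^sub>F i in F. measure (M i) {\<omega> \<in> space (M i). \<bar>Y i \<omega> - 0\<bar> > e} \<le>
      measure (M i) {\<omega> \<in> space (M i). \<bar>Z i \<omega> - 0\<bar> > e} + (1 - measure (M i) (G i))"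
    using M Y le Z[unfolded conv_prob_def, THEN conjunct1]
  proof eventually_elim
    case (elim i)
    interpret prob_space "M i" by fact
    have [measurable]: "Y i \<in> borel_measurable (M i)" "Z i \<in> borel_measurable (M i)" by fact+
    \<comment> \<open>A nonmeasurable set has measure 0 by convention, so positive measure gives
      measurability.\<close>
    have Gi: "G i \<in> sets (M i)" using elim(1) measure_notin_sets by fastforce
    have "measure (M i) {\<omega> \<in> space (M i). \<bar>Y i \<omega> - 0\<bar> > e} \<le>
        measure (M i) ({\<omega> \<in> space (M i). \<bar>Z i \<omega> - 0\<bar> > e} \<union> (space (M i) - G i))"
      using elim(4) Gi by (intro finite_measure_mono_AE) auto
    also have "\<dots> \<le> measure (M i) {\<omega> \<in> space (M i). \<bar>Z i \<omega> - 0\<bar> > e} + measure (M i) (space (M i) - G i)"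
      using Gi by (intro measure_Un_le) auto
    also have "measure (M i) (space (M i) - G i) = 1 - measure (M i) (G i)"
      using Gi by (rule prob_compl)
    finally show ?case .
  qed
  moreover have "((\<lambda>i. measure (M i) {\<omega> \<in> space (M i). \<bar>Z i \<omega> - 0\<bar> > e} + (1 - measure (M i) (G i)))
      \<longlongrightarrow> 0) F"
    using tendsto_add[OF conv_probD[OF Z e] tendsto_diff[OF tendsto_const G, of 1]] by simp
  ultimately show "((\<lambda>i. measure (M i) {\<omega> \<in> space (M i). \<bar>Y i \<omega> - 0\<bar> > e}) \<longlongrightarrow> 0) F"
    by (rule tendsto_0_measure_le)
qed

lemma conv_prob_le:
  assumes "\<forall>\<^sub>F i in F. prob_space (M i)"
    and "\<forall>\<^sub>F i in F. Y i \<in> borel_measurable (M i)"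
    and "\<forall>\<^sub>F i in F. \<forall>\<omega>\<in>space (M i). \<bar>Y i \<omega>\<bar> \<le> \<bar>Z i \<omega>\<bar>"
    and "conv_prob M Z 0 F"
  shows "conv_prob M Y 0 F"
proof (rule conv_prob_dominated[where G = "\<lambda>i. space (M i)", OF assms(1,2) _ _ assms(4)])
  have "\<forall>\<^sub>F i in F. measure (M i) (space (M i)) = 1"
    using assms(1) by eventually_elim (rule prob_space.prob_space)
  then show "((\<lambda>i. measure (M i) (space (M i))) \<longlongrightarrow> 1) F" by (rule tendsto_eventually)
  show "\<forall>\<^sub>F i in F. AE \<omega> in M i. \<omega> \<in> space (M i) \<longrightarrow> \<bar>Y i \<omega>\<bar> \<le> \<bar>Z i \<omega>\<bar>"
    using assms(3) by eventually_elim auto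
qed

lemma conv_prob_add:
  assumes M: "\<forall>\<^sub>F i in F. prob_space (M i)" and Y: "conv_prob M Y 0 F" and Z: "conv_prob M Z 0 F"
  shows "conv_prob M (\<lambda>i \<omega>. Y i \<omega> + Z i \<omega>) 0 F"
  unfolding conv_prob_def
proof (intro conjI allI impI)
  have m: "\<forall>\<^sub>F i in F. Y i \<in> borel_measurable (M i)" "\<forall>\<^sub>F i in F. Z i \<in> borel_measurable (M i)"
    using Y Z by (auto simp: conv_prob_def)
  then show "\<forall>\<^sub>F i in F. (\<lambda>\<omega>. Y i \<omega> + Z i \<omega>) \<in> borel_measurable (M i)"
    by eventually_elim simp
  fix e :: real assume e: "e > 0"
  have "\<forall>\<^sub>F i in F. measure (M i) {\<omega> \<in> space (M i). \<bar>Y i \<omega> + Z i \<omega> - 0\<bar> > e} \<le>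
      measure (M i) {\<omega> \<in> space (M i). \<bar>Y i \<omega> - 0\<bar> > e / 2} +
      measure (M i) {\<omega> \<in> space (M i). \<bar>Z i \<omega> - 0\<bar> > e / 2}"
    using M m
  proof eventually_elim
    case (elim i)
    interpret prob_space "M i" by fact
    have [measurable]: "Y i \<in> borel_measurable (M i)" "Z i \<in> borel_measurable (M i)" by fact+
    have "measure (M i) {\<omega> \<in> space (M i). \<bar>Y i \<omega> + Z i \<omega> - 0\<bar> > e} \<le>
        measure (M i) ({\<omega> \<in> space (M i). \<bar>Y i \<omega> - 0\<bar> > e / 2} \<union> {\<omega> \<in> space (M i). \<bar>Z i \<omega> - 0\<bar> > e / 2})"
      by (intro finite_measure_mono) auto
    also have "\<dots> \<le> measure (M i) {\<omega> \<in> space (M i). \<bar>Y i \<omega> - 0\<bar> > e / 2} +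
        measure (M i) {\<omega> \<in> space (M i). \<bar>Z i \<omega> - 0\<bar> > e / 2}"
      by (intro measure_Un_le) auto
    finally show ?case .
  qed
  moreover have "((\<lambda>i. measure (M i) {\<omega> \<in> space (M i). \<bar>Y i \<omega> - 0\<bar> > e / 2} +
      measure (M i) {\<omega> \<in> space (M i). \<bar>Z i \<omega> - 0\<bar> > e / 2}) \<longlongrightarrow> 0) F"
    using tendsto_add[OF conv_probD[OF Y half_gt_zero[OF e]] conv_probD[OF Z half_gt_zero[OF e]]]
    by (simp only: add_0)
  ultimately show "((\<lambda>i. measure (M i) {\<omega> \<in> space (M i). \<bar>Y i \<omega> + Z i \<omega> - 0\<bar> > e}) \<longlongrightarrow> 0) F"
    by (rule tendsto_0_measure_le)
qed

lemma conv_prob_of_tendsto: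
  assumes f: "(f \<longlongrightarrow> c) F"
  shows "conv_prob M (\<lambda>i _. f i) c F"
  unfolding conv_prob_def
proof (intro conjI allI impI)
  fix e :: real assume "e > 0"
  then have "\<forall>\<^sub>F i in F. \<bar>f i - c\<bar> < e" using tendstoD[OF f] by (simp add: dist_real_def)
  then have "\<forall>\<^sub>F i in F. measure (M i) {\<omega> \<in> space (M i). \<bar>f i - c\<bar> > e} = 0"
    by eventually_elim auto
  then show "((\<lambda>i. measure (M i) {\<omega> \<in> space (M i). \<bar>f i - c\<bar> > e}) \<longlongrightarrow> 0) F"
    by (rule tendsto_eventually)
qed simp

lemma conv_prob_cmult:
  assumes Y: "conv_prob M Y 0 F"
  shows "conv_prob M (\<lambda>i \<omega>. c * Y i \<omega>) 0 F"
proof (cases "c = 0")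
  case True
  then show ?thesis using conv_prob_of_tendsto[of "\<lambda>_. 0" 0 F M] by simp
next
  case False
  show ?thesis
    unfolding conv_prob_def
  proof (intro conjI allI impI)
    show "\<forall>\<^sub>F i in F. (\<lambda>\<omega>. c * Y i \<omega>) \<in> borel_measurable (M i)"
      using Y[unfolded conv_prob_def, THEN conjunct1] by eventually_elim simp
    fix e :: real assume e: "e > 0"
    have "\<bar>c * y - 0\<bar> > e \<longleftrightarrow> \<bar>y - 0\<bar> > e / \<bar>c\<bar>" for y
      using False by (simp add: abs_mult field_simps)
    moreover have "e / \<bar>c\<bar> > 0" using e False by simp
    ultimately show "((\<lambda>i. measure (M i) {\<omega> \<in> space (M i). \<bar>c * Y i \<omega> - 0\<bar> > e}) \<longlongrightarrow> 0) F"
      using conv_probD[OF Y, of "e / \<bar>c\<bar>"] by (simp only:)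
  qed
qed

lemma conv_prob_sum:
  assumes "\<forall>\<^sub>F i in F. prob_space (M i)" "finite A" "\<And>a. a \<in> A \<Longrightarrow> conv_prob M (Y a) 0 F"
  shows "conv_prob M (\<lambda>i \<omega>. \<Sum>a\<in>A. Y a i \<omega>) 0 F"
  using assms(2,3)
proof (induction A rule: finite_induct)
  case empty
  then show ?case using conv_prob_of_tendsto[of "\<lambda>_. 0" 0 F M] by simp
next
  case (insert a A)
  then show ?case using conv_prob_add[OF assms(1), of "Y a" "\<lambda>i \<omega>. \<Sum>a\<in>A. Y a i \<omega>"] by simp
qed

lemma conv_prob_abs: "conv_prob M Y 0 F \<Longrightarrow> conv_prob M (\<lambda>i \<omega>. \<bar>Y i \<omega>\<bar>) 0 F"
  unfolding conv_prob_def by (intro conjI) (auto elim: eventually_mono intro: borel_measurable_abs)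

lemma conv_prob_minus_limit:
  "conv_prob M Y c F \<longleftrightarrow> conv_prob M (\<lambda>i \<omega>. Y i \<omega> - c) 0 F"
proof -
  have "Y i \<in> borel_measurable (M i) \<longleftrightarrow> (\<lambda>\<omega>. Y i \<omega> - c) \<in> borel_measurable (M i)" for i
  proof
    assume "(\<lambda>\<omega>. Y i \<omega> - c) \<in> borel_measurable (M i)"
    then have "(\<lambda>\<omega>. Y i \<omega> - c + c) \<in> borel_measurable (M i)" by (intro borel_measurable_add) auto
    then show "Y i \<in> borel_measurable (M i)" by simp
  qed simp
  then show ?thesis by (simp add: conv_prob_def)
qed

lemma conv_prob_power2D:
  assumes Y: "\<forall>\<^sub>F i in F. Y i \<in> borel_measurable (M i)"
    and Y2: "conv_prob M (\<lambda>i \<omega>. (Y i \<omega>)\<^sup>2) 0 F"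
  shows "conv_prob M Y 0 F"
  unfolding conv_prob_def
proof (intro conjI allI impI Y)
  fix e :: real assume e: "e > 0"
  have "\<bar>y\<^sup>2 - 0\<bar> > e\<^sup>2 \<longleftrightarrow> \<bar>y - 0\<bar> > e" for y :: real
    using abs_le_square_iff[of y e] e by auto
  moreover have "e\<^sup>2 > 0" using e by simp
  ultimately show "((\<lambda>i. measure (M i) {\<omega> \<in> space (M i). \<bar>Y i \<omega> - 0\<bar> > e}) \<longlongrightarrow> 0) F"
    using conv_probD[OF Y2, of "e\<^sup>2"] by (simp only:)
qed

section \<open>The random part vanishes in Frobenius norm\<close>

lemma subalgebra_sigma_limit:
  assumes "random_mat M N N S" "\<And>s. random_vec M N (\<lambda>\<omega>. \<psi>\<^sub>1 \<omega> s)"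
    and "\<And>v. v \<in> carrier_vec N \<Longrightarrow> random_vec M K (\<lambda>\<omega>. \<psi>\<^sub>2 \<omega> v)"
  shows "subalgebra M (sigma_limit M N K S \<psi>\<^sub>1 \<psi>\<^sub>2)"
  unfolding subalgebra_def sigma_limit_def
proof (intro conjI)
  let ?G = "{(\<lambda>\<omega>. S \<omega> $$ (i, j)) -` B \<inter> space M | i j B. i < N \<and> j < N \<and> B \<in> sets borel} \<union>
      {(\<lambda>\<omega>. \<psi>\<^sub>1 \<omega> s $ i) -` B \<inter> space M | s i B. i < N \<and> B \<in> sets borel} \<union>
      {(\<lambda>\<omega>. \<psi>\<^sub>2 \<omega> v $ k) -` B \<inter> space M | v k B.
         v \<in> carrier_vec N \<and> k < K \<and> B \<in> sets borel}"
  have "(\<lambda>\<omega>. S \<omega> $$ (i, j)) -` B \<inter> space M \<in> sets M" if "i < N" "j < N" "B \<in> sets borel" for i j B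
    using assms(1) that by (intro measurable_sets[of _ _ borel]) (auto simp: random_mat_def)
  moreover have "(\<lambda>\<omega>. \<psi>\<^sub>1 \<omega> s $ i) -` B \<inter> space M \<in> sets M" if "i < N" "B \<in> sets borel" for s i B
    using assms(2) that by (intro measurable_sets[of _ _ borel]) (auto simp: random_vec_def)
  moreover have "(\<lambda>\<omega>. \<psi>\<^sub>2 \<omega> v $ k) -` B \<inter> space M \<in> sets M"
    if "v \<in> carrier_vec N" "k < K" "B \<in> sets borel" for v k B
    using assms(3) that by (intro measurable_sets[of _ _ borel]) (auto simp: random_vec_def)
  ultimately have G: "?G \<subseteq> sets M" by blast
  then have "?G \<subseteq> Pow (space M)" using sets.space_closed by blast
  then show "sets (sigma (space M) ?G) \<subseteq> sets M"
    using sets.sigma_sets_subset[OF G] by (simp only: sets_measure_of)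
qed (simp add: space_measure_of_conv)

text \<open>This is what admits the output of psi_1 as the test vector in
  \<open>bound\<close>.\<close>

lemma random_vec_sigma_limit:
  assumes "\<And>s. random_vec M N (\<lambda>\<omega>. \<psi>\<^sub>1 \<omega> s)"
  shows "random_vec (sigma_limit M N K S \<psi>\<^sub>1 \<psi>\<^sub>2) N (\<lambda>\<omega>. \<psi>\<^sub>1 \<omega> s)"
proof -
  have sp: "space (sigma_limit M N K S \<psi>\<^sub>1 \<psi>\<^sub>2) = space M"
    by (simp add: sigma_limit_def space_measure_of_conv)
  have "(\<lambda>\<omega>. \<psi>\<^sub>1 \<omega> s $ i) \<in> borel_measurable (sigma_limit M N K S \<psi>\<^sub>1 \<psi>\<^sub>2)" if i: "i < N" for i
  proof (rule measurableI)
    fix B :: "real set" assume "B \<in> sets borel"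
    then have "(\<lambda>\<omega>. \<psi>\<^sub>1 \<omega> s $ i) -` B \<inter> space M \<in>
        {(\<lambda>\<omega>. \<psi>\<^sub>1 \<omega> s $ i) -` B \<inter> space M | s i B. i < N \<and> B \<in> sets borel}"
      using i by blast
    then show "(\<lambda>\<omega>. \<psi>\<^sub>1 \<omega> s $ i) -` B \<inter> space (sigma_limit M N K S \<psi>\<^sub>1 \<psi>\<^sub>2)
        \<in> sets (sigma_limit M N K S \<psi>\<^sub>1 \<psi>\<^sub>2)"
      unfolding sp unfolding sigma_limit_def by (subst sets_measure_of) auto
  qed simp
  then show ?thesis using assms[of s] sp by (simp add: random_vec_def)
qed

lemma (in gaussian_limit_layer) subalgebra_\<F>: "N > 0 \<Longrightarrow> subalgebra (M N) (\<F> N)"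
  unfolding \<F>_def by (intro subalgebra_sigma_limit S \<Psi>\<^sub>1 \<Psi>\<^sub>2)

definition (in gaussian_limit_layer) large_response where
  "large_response N s =
     {\<omega> \<in> space (M N). max_norm (R N \<omega> *\<^sub>v \<Psi>\<^sub>1 N \<omega> s) > d\<^sub>1 N * J (\<Psi>\<^sub>1 N \<omega> s)}"

text \<open>\<open>bound\<close> is conditional; integrating the conditional probability over the
  whole space makes it an unconditional estimate.\<close>

lemma (in gaussian_limit_layer) large_response:
  assumes N: "N > 0"
  shows "large_response N s \<in> sets (M N)" "measure (M N) (large_response N s) \<le> d\<^sub>2 N"
proof -
  interpret prob_space "M N" using N by (rule prob_space)
  interpret finite_measure_subalgebra "M N" "\<F> N"
    by unfold_locales (rule subalgebra_\<F>[OF N])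
  have "random_vec (\<F> N) N (\<lambda>\<omega>. \<Psi>\<^sub>1 N \<omega> s)"
    unfolding \<F>_def by (intro random_vec_sigma_limit \<Psi>\<^sub>1 N)
  note b = bound[OF N this, folded large_response_def]
  show sets: "large_response N s \<in> sets (M N)" using b by blast
  let ?f = "indicator (large_response N s) :: 'a \<Rightarrow> real"
  have int: "integrable (M N) ?f" using sets by (simp add: emeasure_eq_measure)
  have "measure (M N) (large_response N s) = integral\<^sup>L (M N) ?f" using sets by simp
  also have "\<dots> = integral\<^sup>L (M N) (real_cond_exp (M N) (\<F> N) ?f)"
    by (rule real_cond_exp_int(2)[OF int, symmetric])
  also have "\<dots> \<le> integral\<^sup>L (M N) (\<lambda>_. d\<^sub>2 N)"
    using b real_cond_exp_int(1)[OF int] by (intro integral_mono_AE) (auto simp: cond_prob_sigma_def)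
  also have "\<dots> = d\<^sub>2 N" by (simp add: prob_space)
  finally show "measure (M N) (large_response N s) \<le> d\<^sub>2 N" .
qed

section \<open>The loss along the segment\<close>

lemma (in gaussian_limit_layer) alpha_scaled_1:
  assumes "N > 0" "\<omega> \<in> space (M N)"
  shows "alpha_scaled N 1 \<omega> = \<alpha>s N \<omega>"
proof -
  have "1 \<cdot>\<^sub>m R N \<omega> = R N \<omega>" by (intro eq_matI) auto
  then have "scaled_layer (S N \<omega>) (R N \<omega>) 1 = layer (\<alpha>s N \<omega>)"
    using decomposition[OF assms] by (simp add: scaled_layer_def W\<^sub>2_def)
  then show ?thesis by (cases "\<alpha>s N \<omega>") (simp add: alpha_scaled_def)
qed

lemma (in gaussian_limit_layer) S_carrier: "N > 0 \<Longrightarrow> \<omega> \<in> space (M N) \<Longrightarrow> S N \<omega> \<in> carrier_mat N N"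
  and R_carrier: "N > 0 \<Longrightarrow> \<omega> \<in> space (M N) \<Longrightarrow> R N \<omega> \<in> carrier_mat N N"
  and \<Psi>\<^sub>1_carrier: "N > 0 \<Longrightarrow> \<omega> \<in> space (M N) \<Longrightarrow> \<Psi>\<^sub>1 N \<omega> s \<in> carrier_vec N"
  and \<Psi>\<^sub>2_carrier: "N > 0 \<Longrightarrow> \<omega> \<in> space (M N) \<Longrightarrow> v \<in> carrier_vec N \<Longrightarrow> \<Psi>\<^sub>2 N \<omega> v \<in> carrier_vec K"
  using S[of N] R[of N] \<Psi>\<^sub>1[of N s] \<Psi>\<^sub>2[of N v] by (auto simp: random_mat_def random_vec_def)

text \<open>Moving from \<open>\<theta> = 1\<close> to \<open>\<theta> = 1 - h\<close> perturbs the input of \<open>\<psi>\<^sub>2\<close> by \<open>h R \<psi>\<^sub>1(s)\<close>, hence the logits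
  by at most \<open>h a\<^sub>\<phi>\<close>; \<open>ln \<circ> softmax\<close> doubles this at worst.\<close>

lemma (in gaussian_limit_layer) ln_softmax_alpha_scaled:
  assumes N: "N > 0" and \<omega>: "\<omega> \<in> space (M N)" and s: "s \<in> T" and h: "0 < h" "h \<le> 1"
    and fac: "\<forall>\<theta>\<in>{0..1}. \<forall>s. softmax (X N s (alpha_scaled N \<theta> \<omega>)) =
          softmax (\<Psi>\<^sub>2 N \<omega> (scaled_layer (S N \<omega>) (R N \<omega>) \<theta> *\<^sub>v \<Psi>\<^sub>1 N \<omega> s))"
    and U: "(\<lambda>\<theta>. scaled_layer (S N \<omega>) (R N \<omega>) \<theta> *\<^sub>v \<Psi>\<^sub>1 N \<omega> s) ` {0..1} \<subseteq> U N \<omega> s"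
      "U N \<omega> s \<subseteq> carrier_vec N" "L\<psi>\<^sub>2 N \<omega> s < \<infinity>"
    and small: "\<omega> \<notin> large_response N s"
  shows "ln (softmax (X N s (\<alpha>s N \<omega>)) $ C s) - ln (softmax (X N s (alpha_scaled N (1 - h) \<omega>)) $ C s)
    \<le> h * (2 * a\<^sub>\<phi> N s \<omega>)"
proof -
  define v where "v \<theta> = scaled_layer (S N \<omega>) (R N \<omega>) \<theta> *\<^sub>v \<Psi>\<^sub>1 N \<omega> s" for \<theta>
  let ?r = "R N \<omega> *\<^sub>v \<Psi>\<^sub>1 N \<omega> s"
  note c = S_carrier[OF N \<omega>] R_carrier[OF N \<omega>] \<Psi>\<^sub>1_carrier[OF N \<omega>, of s]
  have vU: "v \<theta> \<in> U N \<omega> s" if "\<theta> \<in> {0..1}" for \<theta> using U(1) that by (auto simp: v_def)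
  have vc: "v \<theta> \<in> carrier_vec N" if "\<theta> \<in> {0..1}" for \<theta> using vU[OF that] U(2) by blast
  have h01: "1 - h \<in> {0..1}" "(1::real) \<in> {0..1}" using h by auto
  have r: "max_norm ?r \<le> d\<^sub>1 N * J (\<Psi>\<^sub>1 N \<omega> s)"
    using small \<omega> by (simp add: large_response_def)
  have "max_norm (v (1 - h) - v 1) \<le> h * max_norm ?r"
  proof (rule max_norm_leI)
    fix i assume "i < dim_vec (v (1 - h) - v 1)"
    then have i: "i < N" using vc[OF h01(2)] by simp
    have "(v (1 - h) - v 1) $ i = - h * ?r $ i"
      unfolding v_def scaled_layer_mult_vec[OF c] using i c
      by (simp add: algebra_simps del: index_mult_mat_vec)
    then show "\<bar>(v (1 - h) - v 1) $ i\<bar> \<le> h * max_norm ?r"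
      using abs_vec_index_le_max_norm[of i ?r] c i h by (simp add: abs_mult del: index_mult_mat_vec)
  qed (use h in simp)
  also have "\<dots> \<le> h * (d\<^sub>1 N * J (\<Psi>\<^sub>1 N \<omega> s))" using r h by (intro mult_left_mono) auto
  finally have dv: "max_norm (v (1 - h) - v 1) \<le> h * (d\<^sub>1 N * J (\<Psi>\<^sub>1 N \<omega> s))" .
  \<comment> \<open>Both arguments lie on the segment inside U, where the Lipschitz constant is
    valid.\<close>
  have "max_norm (\<Psi>\<^sub>2 N \<omega> (v (1 - h)) - \<Psi>\<^sub>2 N \<omega> (v 1)) \<le>
      enn2real (L\<psi>\<^sub>2 N \<omega> s) * max_norm (v (1 - h) - v 1)"
    unfolding L\<psi>\<^sub>2_def
    by (rule max_norm_diff_le_lip_const[of _ N _ _ _ K])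
      (use U vU vc h01 \<Psi>\<^sub>2_carrier[OF N \<omega>] in \<open>auto simp: L\<psi>\<^sub>2_def\<close>)
  also have "\<dots> \<le> enn2real (L\<psi>\<^sub>2 N \<omega> s) * (h * (d\<^sub>1 N * J (\<Psi>\<^sub>1 N \<omega> s)))"
    using dv by (intro mult_left_mono) auto
  also have "\<dots> = h * a\<^sub>\<phi> N s \<omega>" by (simp add: a\<^sub>\<phi>_def)
  finally have "ln (softmax (\<Psi>\<^sub>2 N \<omega> (v 1)) $ C s) - ln (softmax (\<Psi>\<^sub>2 N \<omega> (v (1 - h))) $ C s)
      \<le> 2 * (h * a\<^sub>\<phi> N s \<omega>)"
    by (intro ln_softmax_diff_le[of _ K] \<Psi>\<^sub>2_carrier[OF N \<omega>] vc h01 C s)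
  then show ?thesis
    using fac h01 unfolding alpha_scaled_1[OF N \<omega>, symmetric] v_def by simp
qed

text \<open>The remainder proportional to h stays explicit, so one bound serves for all h up to 1.
  Only the cross entropy is estimated; the penalty is an exact quadratic polynomial in
  \<theta>.\<close>

lemma (in gaussian_limit_layer) net_loss_difference_quotient:
  assumes N: "N > 0" and \<omega>: "\<omega> \<in> space (M N)" and h: "0 < h" "h \<le> 1"
    and fac: "\<forall>\<theta>\<in>{0..1}. \<forall>s. softmax (X N s (alpha_scaled N \<theta> \<omega>)) =
          softmax (\<Psi>\<^sub>2 N \<omega> (scaled_layer (S N \<omega>) (R N \<omega>) \<theta> *\<^sub>v \<Psi>\<^sub>1 N \<omega> s))"
    and U: "\<forall>s\<in>T. (\<lambda>\<theta>. scaled_layer (S N \<omega>) (R N \<omega>) \<theta> *\<^sub>v \<Psi>\<^sub>1 N \<omega> s) ` {0..1} \<subseteq> U N \<omega> s \<and>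
      U N \<omega> s \<subseteq> carrier_vec N \<and> L\<psi>\<^sub>2 N \<omega> s < \<infinity>"
    and small: "\<forall>s\<in>T. \<omega> \<notin> large_response N s"
  shows "(net_loss N (alpha_scaled N (1 - h) \<omega>) - net_loss N (\<alpha>s N \<omega>)) / h \<le>
    2 / real (card T) * (\<Sum>s\<in>T. a\<^sub>\<phi> N s \<omega>)
      - 2 * lam * (frob_inner (S N \<omega>) (R N \<omega>) + (frob_norm (R N \<omega>))\<^sup>2) + h * (lam * (frob_norm (R N \<omega>))\<^sup>2)"
proof -
  let ?p = "\<lambda>\<theta> s. ln (softmax (X N s (alpha_scaled N \<theta> \<omega>)) $ C s)"
  let ?F = "\<lambda>\<theta>. (frob_norm (scaled_layer (S N \<omega>) (R N \<omega>) \<theta>))\<^sup>2"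
  \<comment> \<open>From (1 - h) - 1 = - h and (1 - h)^2 - 1 = - 2 h + h^2.\<close>
  have reg: "?F (1 - h) - ?F 1 =
      h * (- 2 * (frob_inner (S N \<omega>) (R N \<omega>) + (frob_norm (R N \<omega>))\<^sup>2) + h * (frob_norm (R N \<omega>))\<^sup>2)"
    unfolding frob_norm_scaled_layer_sq[OF S_carrier[OF N \<omega>] R_carrier[OF N \<omega>]]
    by (simp add: algebra_simps power2_eq_square)
  have "(\<Sum>s\<in>T. ?p 1 s - ?p (1 - h) s) \<le> (\<Sum>s\<in>T. h * (2 * a\<^sub>\<phi> N s \<omega>))"
    using ln_softmax_alpha_scaled[OF N \<omega> _ h fac] U small alpha_scaled_1[OF N \<omega>]
    by (intro sum_mono) auto
  then have ce: "1 / real (card T) * (\<Sum>s\<in>T. ?p 1 s - ?p (1 - h) s) \<le>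
      1 / real (card T) * (h * (2 * (\<Sum>s\<in>T. a\<^sub>\<phi> N s \<omega>)))"
    by (intro mult_left_mono) (simp_all add: sum_distrib_left)
  \<comment> \<open>The other weight matrices agree at both points, so their penalties
    cancel.\<close>
  have "net_loss N (alpha_scaled N (1 - h) \<omega>) - net_loss N (\<alpha>s N \<omega>) =
      1 / real (card T) * (\<Sum>s\<in>T. ?p 1 s - ?p (1 - h) s) + lam * (?F (1 - h) - ?F 1)"
    unfolding alpha_scaled_1[OF N \<omega>, symmetric] net_loss_def loss_def
    by (simp add: weights_def alpha_scaled_def sum_subtractf algebra_simps diff_divide_distrib)
  also have "\<dots> \<le> 1 / real (card T) * (h * (2 * (\<Sum>s\<in>T. a\<^sub>\<phi> N s \<omega>))) + lam * (?F (1 - h) - ?F 1)"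
    using ce by simp
  also have "\<dots> = h * (2 / real (card T) * (\<Sum>s\<in>T. a\<^sub>\<phi> N s \<omega>)
      - 2 * lam * (frob_inner (S N \<omega>) (R N \<omega>) + (frob_norm (R N \<omega>))\<^sup>2) + h * (lam * (frob_norm (R N \<omega>))\<^sup>2))"
    unfolding reg by (simp add: algebra_simps)
  finally show ?thesis using h by (subst pos_divide_le_eq) (simp_all add: mult.commute)
qed

definition (in gaussian_limit_layer) minimality :: "nat \<Rightarrow> 'a set" where
  "minimality N = {\<omega> \<in> space (M N).
     Liminf (at_right 0) (\<lambda>h. ereal
       ((net_loss N (alpha_scaled N (1 - h) \<omega>) - net_loss N (\<alpha>s N \<omega>)) / h)) \<ge> ereal (- eps N \<omega>)}"

text \<open>On this event the right-sided liminf is at least \<open>- eps N \<omega>\<close> and at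
  most the value of the quotient bound at h = 0. Solving for the squared norm divides by 2 lam,
  which must be positive.\<close>

lemma (in gaussian_limit_layer) frob_norm_R_sq_le:
  assumes N: "N > 0"
    and fac: "\<forall>\<theta>\<in>{0..1}. \<forall>s. softmax (X N s (alpha_scaled N \<theta> \<omega>)) =
          softmax (\<Psi>\<^sub>2 N \<omega> (scaled_layer (S N \<omega>) (R N \<omega>) \<theta> *\<^sub>v \<Psi>\<^sub>1 N \<omega> s))"
    and U: "\<forall>s\<in>T. (\<lambda>\<theta>. scaled_layer (S N \<omega>) (R N \<omega>) \<theta> *\<^sub>v \<Psi>\<^sub>1 N \<omega> s) ` {0..1} \<subseteq> U N \<omega> s \<and>
      U N \<omega> s \<subseteq> carrier_vec N \<and> L\<psi>\<^sub>2 N \<omega> s < \<infinity>"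
    and \<omega>: "\<omega> \<in> minimality N - (\<Union>s\<in>T. large_response N s)"
  shows "(frob_norm (R N \<omega>))\<^sup>2 \<le> 1 / (2 * lam) * (eps N \<omega> + 2 / real (card T) * (\<Sum>s\<in>T. a\<^sub>\<phi> N s \<omega>)) +
    \<bar>frob_inner (S N \<omega>) (R N \<omega>)\<bar>"
proof -
  have sp: "\<omega> \<in> space (M N)" using \<omega> by (simp add: minimality_def)
  let ?q = "\<lambda>h. (net_loss N (alpha_scaled N (1 - h) \<omega>) - net_loss N (\<alpha>s N \<omega>)) / h"
  let ?c = "2 / real (card T) * (\<Sum>s\<in>T. a\<^sub>\<phi> N s \<omega>)
      - 2 * lam * (frob_inner (S N \<omega>) (R N \<omega>) + (frob_norm (R N \<omega>))\<^sup>2)"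
  let ?b = "\<lambda>h. ?c + h * (lam * (frob_norm (R N \<omega>))\<^sup>2)"
  have "\<forall>\<^sub>F h in at_right (0::real). 0 < h \<and> h \<le> 1"
    unfolding eventually_at_right_field by (intro exI[of _ 1]) auto
  then have "\<forall>\<^sub>F h in at_right 0. ereal (?q h) \<le> ereal (?b h)"
    by eventually_elim (use net_loss_difference_quotient[OF N sp _ _ fac U] \<omega> in auto)
  then have "Liminf (at_right 0) (\<lambda>h. ereal (?q h)) \<le> Liminf (at_right 0) (\<lambda>h. ereal (?b h))"
    by (rule Liminf_mono)
  \<comment> \<open>The upper bound is affine in h, so its liminf is an actual limit.\<close>
  also have "Liminf (at_right 0) (\<lambda>h. ereal (?b h)) = ereal ?c"
  proof (rule lim_imp_Liminf)
    have "(?b \<longlongrightarrow> ?c + 0 * (lam * (frob_norm (R N \<omega>))\<^sup>2)) (at_right 0)"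
      by (intro tendsto_intros)
    then show "((\<lambda>h. ereal (?b h)) \<longlongrightarrow> ereal ?c) (at_right 0)" by simp
  qed simp
  finally have "ereal (- eps N \<omega>) \<le> ereal ?c"
    using \<omega> by (simp only: minimality_def Diff_iff mem_Collect_eq) (meson order_trans)
  then have "2 * lam * (frob_norm (R N \<omega>))\<^sup>2 \<le>
      eps N \<omega> + 2 / real (card T) * (\<Sum>s\<in>T. a\<^sub>\<phi> N s \<omega>) + 2 * lam * (- frob_inner (S N \<omega>) (R N \<omega>))"
    by (simp add: algebra_simps)
  also have "\<dots> \<le> eps N \<omega> + 2 / real (card T) * (\<Sum>s\<in>T. a\<^sub>\<phi> N s \<omega>) + 2 * lam * \<bar>frob_inner (S N \<omega>) (R N \<omega>)\<bar>"
    using lam by (intro add_left_mono mult_left_mono) auto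
  finally have "(frob_norm (R N \<omega>))\<^sup>2 \<le>
      (eps N \<omega> + 2 / real (card T) * (\<Sum>s\<in>T. a\<^sub>\<phi> N s \<omega>) + 2 * lam * \<bar>frob_inner (S N \<omega>) (R N \<omega>)\<bar>) / (2 * lam)"
    using lam by (subst pos_le_divide_eq) (simp_all add: mult.commute)
  then show ?thesis using lam by (simp add: add_divide_distrib)
qed

text \<open>The union bound costs |T| d_2, which vanishes because T is finite and the same for all
  N.\<close>

lemma (in gaussian_limit_layer) prob_minimality_tendsto:
  "(\<lambda>N. measure (M N) (minimality N - (\<Union>s\<in>T. large_response N s))) \<longlonglongrightarrow> 1"
proof (rule real_tendsto_sandwich)
  have m: "(\<lambda>N. measure (M N) (minimality N)) \<longlonglongrightarrow> 1"
    using minimal unfolding minimality_def .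
  show "(\<lambda>N. measure (M N) (minimality N) - real (card T) * d\<^sub>2 N) \<longlonglongrightarrow> 1"
    using tendsto_diff[OF m tendsto_mult[OF tendsto_const d(4)], of "real (card T)"] by simp
  have pos: "\<forall>\<^sub>F N in sequentially. N > (0::nat)" by (rule eventually_gt_at_top)
  have "\<forall>\<^sub>F N in sequentially. measure (M N) (minimality N) > 0"
    using m by (rule order_tendstoD) simp
  then show "\<forall>\<^sub>F N in sequentially. measure (M N) (minimality N) - real (card T) * d\<^sub>2 N \<le>
      measure (M N) (minimality N - (\<Union>s\<in>T. large_response N s))"
    using pos
  proof eventually_elim
    case (elim N)
    let ?B = "\<Union>s\<in>T. large_response N s"
    \<comment> \<open>\<open>minimal\<close> does not state that this event is measurable; its
      positive measure shows it.\<close>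
    have A: "minimality N \<in> sets (M N)" using elim(1) measure_notin_sets by fastforce
    have B: "?B \<in> sets (M N)" using large_response(1)[OF elim(2)] T by (intro sets.finite_UN) auto
    interpret prob_space "M N" using elim(2) by (rule prob_space)
    have "measure (M N) (minimality N) \<le> measure (M N) ((minimality N - ?B) \<union> ?B)"
      using A B by (intro finite_measure_mono) auto
    also have "\<dots> \<le> measure (M N) (minimality N - ?B) + measure (M N) ?B"
      using A B by (intro measure_Un_le) auto
    also have "measure (M N) ?B \<le> (\<Sum>s\<in>T. measure (M N) (large_response N s))"
      using T large_response(1)[OF elim(2)] by (intro measure_UNION_le) auto
    also have "\<dots> \<le> (\<Sum>s\<in>T. d\<^sub>2 N)"
      using large_response(2)[OF elim(2)] by (intro sum_mono)
    finally show ?case by simp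
  qed
  show "\<forall>\<^sub>F N in sequentially. measure (M N) (minimality N - (\<Union>s\<in>T. large_response N s)) \<le> 1"
    using pos by eventually_elim (intro prob_space.prob_le_1 prob_space)
qed simp

lemma (in gaussian_limit_layer) eventually_prob_space: "\<forall>\<^sub>F N in sequentially. prob_space (M N)"
  using eventually_gt_at_top[of 0] by eventually_elim (rule prob_space)

lemma (in gaussian_limit_layer) borel_measurable_frob_norm_R:
  assumes "N > 0"
  shows "(\<lambda>\<omega>. frob_norm (R N \<omega>)) \<in> borel_measurable (M N)"
proof -
  have "frob_norm (R N \<omega> - 0\<^sub>m N N) = frob_norm (R N \<omega>)" if "\<omega> \<in> space (M N)" for \<omega>
    using R_carrier[OF assms that] by (simp add: frob_norm_def frob_inner_def)
  then show ?thesis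
    using borel_measurable_frob_norm_diff[OF R[OF assms], of "0\<^sub>m N N"] by (simp cong: measurable_cong)
qed

lemma (in gaussian_limit_layer) frob_norm_R_sq_tendsto:
  "conv_prob M (\<lambda>N \<omega>. (frob_norm (R N \<omega>))\<^sup>2) 0 sequentially"
proof -
  have pos: "\<forall>\<^sub>F N in sequentially. N > (0::nat)" by (rule eventually_gt_at_top)
  have meas: "\<forall>\<^sub>F N in sequentially. (\<lambda>\<omega>. frob_norm (R N \<omega>)) \<in> borel_measurable (M N)"
    using pos by eventually_elim (rule borel_measurable_frob_norm_R)
  let ?Z = "\<lambda>N \<omega>. 1 / (2 * lam) * (eps N \<omega> + 2 / real (card T) * (\<Sum>s\<in>T. a\<^sub>\<phi> N s \<omega>)) +
    \<bar>frob_inner (S N \<omega>) (R N \<omega>)\<bar>"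
  show ?thesis
  proof (rule conv_prob_dominated[OF eventually_prob_space _ prob_minimality_tendsto])
    show "\<forall>\<^sub>F N in sequentially. (\<lambda>\<omega>. (frob_norm (R N \<omega>))\<^sup>2) \<in> borel_measurable (M N)"
      using meas by eventually_elim simp
    show "conv_prob M ?Z 0 sequentially"
      by (intro conv_prob_add eventually_prob_space conv_prob_cmult conv_prob_sum T a\<^sub>\<phi> eps
          conv_prob_abs orthogonal)
    show "\<forall>\<^sub>F N in sequentially. AE \<omega> in M N.
        \<omega> \<in> minimality N - (\<Union>s\<in>T. large_response N s) \<longrightarrow> \<bar>(frob_norm (R N \<omega>))\<^sup>2\<bar> \<le> \<bar>?Z N \<omega>\<bar>"
      using pos
    proof eventually_elim
      case (elim N)
      \<comment> \<open>T is finite, so the union of the exceptional null sets is null.\<close>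
      have "AE \<omega> in M N. \<forall>s\<in>T. (\<lambda>\<theta>. scaled_layer (S N \<omega>) (R N \<omega>) \<theta> *\<^sub>v \<Psi>\<^sub>1 N \<omega> s) ` {0..1} \<subseteq> U N \<omega> s \<and>
          U N \<omega> s \<subseteq> carrier_vec N \<and> L\<psi>\<^sub>2 N \<omega> s < \<infinity>"
        using U[OF elim] T(1) by (intro AE_finite_allI)
      with factorization[OF elim] show ?case
      proof eventually_elim
        case (elim \<omega>)
        show ?case
        proof
          assume "\<omega> \<in> minimality N - (\<Union>s\<in>T. large_response N s)"
          from frob_norm_R_sq_le[OF \<open>N > 0\<close> elim this]
          show "\<bar>(frob_norm (R N \<omega>))\<^sup>2\<bar> \<le> \<bar>?Z N \<omega>\<bar>" by (simp only: abs_power2)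
        qed
      qed
    qed
  qed
qed

lemma (in gaussian_limit_layer) frob_norm_R_tendsto:
  "conv_prob M (\<lambda>N \<omega>. frob_norm (R N \<omega>)) 0 sequentially"
proof (rule conv_prob_power2D[OF _ frob_norm_R_sq_tendsto])
  show "\<forall>\<^sub>F N in sequentially. (\<lambda>\<omega>. frob_norm (R N \<omega>)) \<in> borel_measurable (M N)"
    using eventually_gt_at_top[of 0] by eventually_elim (rule borel_measurable_frob_norm_R)
qed

section \<open>Consequences for the spectrum\<close>

text \<open>The first k indices are counted in full; beyond them Chebyshev's inequality is applied
  to counting measure.\<close>

lemma card_sing_val_gt_le:
  assumes "\<epsilon> > 0"
  shows "real (card {i \<in> {1..N}. sing_val A i > \<epsilon>}) \<le>
    real k + 1 / \<epsilon>\<^sup>2 * (\<Sum>i\<in>{k<..N}. (sing_val A i)\<^sup>2)"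
proof -
  let ?H = "{i \<in> {k<..N}. sing_val A i > \<epsilon>}"
  have "card {i \<in> {1..N}. sing_val A i > \<epsilon>} \<le> card ({1..k} \<union> ?H)"
    by (intro card_mono) auto
  also have "\<dots> \<le> k + card ?H" using card_Un_le[of "{1..k}" ?H] by simp
  finally have 1: "card {i \<in> {1..N}. sing_val A i > \<epsilon>} \<le> k + card ?H" .
  have "\<epsilon>\<^sup>2 * real (card ?H) = (\<Sum>i\<in>?H. \<epsilon>\<^sup>2)" by simp
  also have "\<dots> \<le> (\<Sum>i\<in>?H. (sing_val A i)\<^sup>2)"
    using assms by (intro sum_mono power_mono) auto
  also have "\<dots> \<le> (\<Sum>i\<in>{k<..N}. (sing_val A i)\<^sup>2)"
    by (intro sum_mono2) auto
  finally have "real (card ?H) \<le> 1 / \<epsilon>\<^sup>2 * (\<Sum>i\<in>{k<..N}. (sing_val A i)\<^sup>2)"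
    using assms by (simp add: field_simps)
  then show ?thesis using 1 by linarith
qed

lemma measure_sv_empirical:
  "measure (sv_empirical A) {\<epsilon><..} =
    1 / real (dim_col A) * real (card {i \<in> {1..dim_col A}. sing_val A i > \<epsilon>})"
proof -
  let ?U = "uniform_count_measure {1..dim_col A}"
  have "measure (sv_empirical A) {\<epsilon><..} = measure ?U (sing_val A -` {\<epsilon><..} \<inter> space ?U)"
    unfolding sv_empirical_def by (intro measure_distr) auto
  also have "sing_val A -` {\<epsilon><..} \<inter> space ?U = {i \<in> {1..dim_col A}. sing_val A i > \<epsilon>}"
    by (auto simp: space_uniform_count_measure)
  also have "measure ?U \<dots> = real (card \<dots>) / real (dim_col A)"
    by (subst measure_uniform_count_measure) auto
  finally show ?thesis by simp
qed

theorem corollary4p10: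
  fixes M :: "nat \<Rightarrow> 'a measure"
    and K :: nat
    and T :: "'s set"
    and C :: "'s \<Rightarrow> nat"
    and lam :: real
    and shapes :: "nat \<Rightarrow> (nat \<times> nat) list"
    and q :: "nat \<Rightarrow> nat"
    and X :: "nat \<Rightarrow> 's \<Rightarrow> params \<Rightarrow> real vec"
    and \<alpha> :: "nat \<Rightarrow> real \<Rightarrow> 'a \<Rightarrow> params"
    and \<alpha>s :: "nat \<Rightarrow> 'a \<Rightarrow> params"
    and S R W :: "nat \<Rightarrow> 'a \<Rightarrow> real mat"
    and \<psi>\<^sub>1 :: "nat \<Rightarrow> rest_params \<Rightarrow> 's \<Rightarrow> real vec"
    and \<psi>\<^sub>2 :: "nat \<Rightarrow> rest_params \<Rightarrow> real vec \<Rightarrow> real vec"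
    and g :: "nat \<Rightarrow> real"
    and U :: "nat \<Rightarrow> 'a \<Rightarrow> 's \<Rightarrow> real vec set"
    and d\<^sub>1 d\<^sub>2 :: "nat \<Rightarrow> real"
    and J :: "real vec \<Rightarrow> real"
    and eps :: "nat \<Rightarrow> 'a \<Rightarrow> real"
    and k :: "nat \<Rightarrow> nat"
  defines "W \<equiv> \<lambda>N \<omega>. layer (\<alpha>s N \<omega>)"
  assumes hyps: "gaussian_limit_layer M K T C lam shapes q X \<alpha> \<alpha>s S R \<psi>\<^sub>1 \<psi>\<^sub>2 g U d\<^sub>1 d\<^sub>2 J eps"
    and k: "(\<lambda>N. real (k N)) \<in> o(\<lambda>N. real N)"
    and admissible:
      "conv_prob M (\<lambda>N \<omega>. \<Sum>i\<in>{k N<..N}. (sing_val (S N \<omega>) i)\<^sup>2) 0 sequentially"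
  shows "conv_prob M (\<lambda>N \<omega>. op_norm (R N \<omega>)) 0 sequentially \<and>
    (\<forall>i\<ge>1. conv_prob M (\<lambda>N \<omega>. \<bar>sing_val (W N \<omega>) i - sing_val (S N \<omega>) i\<bar>) 0 sequentially) \<and>
    conv_prob M (\<lambda>N \<omega>. \<Sum>i\<in>{k N<..N}. (sing_val (W N \<omega>) i)\<^sup>2) 0 sequentially \<and>
    (\<forall>\<epsilon>>0.
       conv_prob M (\<lambda>N \<omega>. measure (sv_empirical (W N \<omega>)) {\<epsilon><..}) 0 sequentially \<and>
       conv_prob M (\<lambda>N \<omega>. 1 / real N * real (card {i \<in> {1..N}. sing_val (W N \<omega>) i > \<epsilon>})) 0
         sequentially) \<and>
    (\<forall>i\<ge>1. \<forall>\<sigma>bar.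
       conv_prob M (\<lambda>N \<omega>. sing_val (S N \<omega>) i) \<sigma>bar sequentially \<longrightarrow>
       conv_prob M (\<lambda>N \<omega>. sing_val (W N \<omega>) i) \<sigma>bar sequentially)"
proof -
  interpret gaussian_limit_layer M K T C lam shapes q X \<alpha> \<alpha>s S R \<psi>\<^sub>1 \<psi>\<^sub>2 g U d\<^sub>1 d\<^sub>2 J eps
    by (rule hyps)
  note prob = eventually_prob_space
  have pos: "\<forall>\<^sub>F N in sequentially. N > (0::nat)" by (rule eventually_gt_at_top)
  have W: "random_mat (M N) N N (W N)" if "N > 0" for N
    using limit[OF that] by (simp add: random_params_def W_def)
  have Wc: "W N \<omega> \<in> carrier_mat N N" if "N > 0" "\<omega> \<in> space (M N)" for N \<omega>
    using W[OF that(1)] that(2) by (auto simp: random_mat_def)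
  \<comment> \<open>The error in every perturbation bound thereby becomes the Frobenius norm of
    R.\<close>
  have WS: "W N \<omega> - S N \<omega> = R N \<omega>" if N: "N > 0" and \<omega>: "\<omega> \<in> space (M N)" for N \<omega>
    using decomposition[OF N \<omega>] S_carrier[OF N \<omega>] R_carrier[OF N \<omega>]
    by (intro eq_matI) (auto simp: W_def W\<^sub>2_def)
  have [measurable]: "(\<lambda>\<omega>. sing_val (W N \<omega>) i) \<in> borel_measurable (M N)"
    "(\<lambda>\<omega>. sing_val (S N \<omega>) i) \<in> borel_measurable (M N)" if "N > 0" for N i
    using borel_measurable_sing_val[OF W[OF that]] borel_measurable_sing_val[OF S[OF that]] by auto
  have op: "conv_prob M (\<lambda>N \<omega>. op_norm (R N \<omega>)) 0 sequentially"
  proof (rule conv_prob_le[OF prob _ _ frob_norm_R_tendsto])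
    show "\<forall>\<^sub>F N in sequentially. (\<lambda>\<omega>. op_norm (R N \<omega>)) \<in> borel_measurable (M N)"
      using pos by eventually_elim (rule borel_measurable_op_norm[OF R])
  qed (simp add: op_norm_le_frob_norm)
  have diff: "conv_prob M (\<lambda>N \<omega>. \<bar>sing_val (W N \<omega>) i - sing_val (S N \<omega>) i\<bar>) 0 sequentially" for i
  proof (rule conv_prob_le[OF prob _ _ frob_norm_R_tendsto])
    show "\<forall>\<^sub>F N in sequentially.
        (\<lambda>\<omega>. \<bar>sing_val (W N \<omega>) i - sing_val (S N \<omega>) i\<bar>) \<in> borel_measurable (M N)"
      using pos by eventually_elim measurable
    show "\<forall>\<^sub>F N in sequentially. \<forall>\<omega>\<in>space (M N).
        \<bar>\<bar>sing_val (W N \<omega>) i - sing_val (S N \<omega>) i\<bar>\<bar> \<le> \<bar>frob_norm (R N \<omega>)\<bar>"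
      using pos
    proof eventually_elim
      case (elim N)
      show ?case
      proof
        fix \<omega> assume "\<omega> \<in> space (M N)"
        note \<omega> = elim this
        show "\<bar>\<bar>sing_val (W N \<omega>) i - sing_val (S N \<omega>) i\<bar>\<bar> \<le> \<bar>frob_norm (R N \<omega>)\<bar>"
          using sing_val_lipschitz[OF Wc[OF \<omega>] S_carrier[OF \<omega>], of i] WS[OF \<omega>] by simp
      qed
    qed
  qed
  have tail: "conv_prob M (\<lambda>N \<omega>. \<Sum>i\<in>{k N<..N}. (sing_val (W N \<omega>) i)\<^sup>2) 0 sequentially"
  proof (rule conv_prob_le[OF prob])
    have "conv_prob M (\<lambda>N \<omega>. (frob_norm (R N \<omega>))\<^sup>2) 0 sequentially"
      by (rule frob_norm_R_sq_tendsto)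
    then show "conv_prob M (\<lambda>N \<omega>. 2 * (\<Sum>i\<in>{k N<..N}. (sing_val (S N \<omega>) i)\<^sup>2) +
        2 * (frob_norm (R N \<omega>))\<^sup>2) 0 sequentially"
      by (intro conv_prob_add conv_prob_cmult prob admissible)
    show "\<forall>\<^sub>F N in sequentially. (\<lambda>\<omega>. \<Sum>i\<in>{k N<..N}. (sing_val (W N \<omega>) i)\<^sup>2) \<in> borel_measurable (M N)"
      using pos by eventually_elim measurable
    show "\<forall>\<^sub>F N in sequentially. \<forall>\<omega>\<in>space (M N). \<bar>\<Sum>i\<in>{k N<..N}. (sing_val (W N \<omega>) i)\<^sup>2\<bar> \<le>
        \<bar>2 * (\<Sum>i\<in>{k N<..N}. (sing_val (S N \<omega>) i)\<^sup>2) + 2 * (frob_norm (R N \<omega>))\<^sup>2\<bar>"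
      using pos
    proof eventually_elim
      case (elim N)
      show ?case
      proof
        fix \<omega> assume "\<omega> \<in> space (M N)"
        note \<omega> = elim this
        have "(\<Sum>i\<in>{k N<..N}. (sing_val (W N \<omega>) i)\<^sup>2) \<ge> 0" by (intro sum_nonneg) simp
        then show "\<bar>\<Sum>i\<in>{k N<..N}. (sing_val (W N \<omega>) i)\<^sup>2\<bar> \<le>
            \<bar>2 * (\<Sum>i\<in>{k N<..N}. (sing_val (S N \<omega>) i)\<^sup>2) + 2 * (frob_norm (R N \<omega>))\<^sup>2\<bar>"
          using sum_tail_sing_val_le[OF Wc[OF \<omega>] S_carrier[OF \<omega>], of "k N"] WS[OF \<omega>] by simp
      qed
    qed
  qed
  have count: "conv_prob M (\<lambda>N \<omega>. 1 / real N * real (card {i \<in> {1..N}. sing_val (W N \<omega>) i > \<epsilon>})) 0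
      sequentially" if \<epsilon>: "\<epsilon> > 0" for \<epsilon>
  proof (rule conv_prob_le[OF prob])
    \<comment> \<open>The k_N indices left uncontrolled by the tail sum have vanishing
      proportion.\<close>
    have "(\<lambda>N. real (k N) / real N) \<longlonglongrightarrow> 0" using k by (rule smalloD_tendsto)
    then show "conv_prob M (\<lambda>N \<omega>. real (k N) / real N +
        1 / \<epsilon>\<^sup>2 * (\<Sum>i\<in>{k N<..N}. (sing_val (W N \<omega>) i)\<^sup>2)) 0 sequentially"
      by (intro conv_prob_add conv_prob_cmult prob tail conv_prob_of_tendsto)
    show "\<forall>\<^sub>F N in sequentially. (\<lambda>\<omega>. 1 / real N * real (card {i \<in> {1..N}. sing_val (W N \<omega>) i > \<epsilon>}))
        \<in> borel_measurable (M N)"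
      using pos
    proof eventually_elim
      case (elim N)
      \<comment> \<open>Written as a sum of indicators, the count inherits measurability from the
        single singular values.\<close>
      have "(\<lambda>\<omega>. 1 / real N * (\<Sum>i\<in>{1..N}. if sing_val (W N \<omega>) i > \<epsilon> then 1 else 0)) \<in> borel_measurable (M N)"
        using elim by measurable
      moreover have "real (card {i \<in> {1..N}. sing_val (W N \<omega>) i > \<epsilon>}) =
          (\<Sum>i\<in>{1..N}. if sing_val (W N \<omega>) i > \<epsilon> then 1 else 0)" for \<omega>
        by (simp add: sum.If_cases Int_def)
      ultimately show ?case by simp
    qed
    show "\<forall>\<^sub>F N in sequentially. \<forall>\<omega>\<in>space (M N).
        \<bar>1 / real N * real (card {i \<in> {1..N}. sing_val (W N \<omega>) i > \<epsilon>})\<bar> \<le>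
        \<bar>real (k N) / real N + 1 / \<epsilon>\<^sup>2 * (\<Sum>i\<in>{k N<..N}. (sing_val (W N \<omega>) i)\<^sup>2)\<bar>"
      using pos
    proof eventually_elim
      case (elim N)
      show ?case
      proof
        fix \<omega>
        let ?t = "1 / \<epsilon>\<^sup>2 * (\<Sum>i\<in>{k N<..N}. (sing_val (W N \<omega>) i)\<^sup>2)"
        have t: "0 \<le> ?t" by (intro mult_nonneg_nonneg sum_nonneg) auto
        have "1 / real N * real (card {i \<in> {1..N}. sing_val (W N \<omega>) i > \<epsilon>}) \<le> 1 / real N * (real (k N) + ?t)"
          by (intro mult_left_mono card_sing_val_gt_le \<epsilon>) simp
        also have "\<dots> = real (k N) / real N + ?t / real N" by (simp add: add_divide_distrib)
        \<comment> \<open>The tail sum tends to 0 by itself, so bounding its factor 1/N by 1 is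
          enough.\<close>
        also have "?t / real N \<le> ?t" using divide_left_mono[OF _ t, of 1 "real N"] elim by simp
        finally have "1 / real N * real (card {i \<in> {1..N}. sing_val (W N \<omega>) i > \<epsilon>}) \<le> real (k N) / real N + ?t"
          by simp
        then show "\<bar>1 / real N * real (card {i \<in> {1..N}. sing_val (W N \<omega>) i > \<epsilon>})\<bar> \<le> \<bar>real (k N) / real N + ?t\<bar>"
          by simp
      qed
    qed
  qed
  have empirical: "conv_prob M (\<lambda>N \<omega>. measure (sv_empirical (W N \<omega>)) {\<epsilon><..}) 0 sequentially"
    if \<epsilon>: "\<epsilon> > 0" for \<epsilon>
  proof (rule conv_prob_le[OF prob _ _ count[OF \<epsilon>]])
    have eq: "measure (sv_empirical (W N \<omega>)) {\<epsilon><..} =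
        1 / real N * real (card {i \<in> {1..N}. sing_val (W N \<omega>) i > \<epsilon>})" if "N > 0" "\<omega> \<in> space (M N)" for N \<omega>
      using Wc[OF that] by (simp add: measure_sv_empirical)
    show "\<forall>\<^sub>F N in sequentially. (\<lambda>\<omega>. measure (sv_empirical (W N \<omega>)) {\<epsilon><..}) \<in> borel_measurable (M N)"
      using pos count[OF \<epsilon>, unfolded conv_prob_def, THEN conjunct1]
      by eventually_elim (simp add: eq cong: measurable_cong)
    show "\<forall>\<^sub>F N in sequentially. \<forall>\<omega>\<in>space (M N). \<bar>measure (sv_empirical (W N \<omega>)) {\<epsilon><..}\<bar> \<le>
        \<bar>1 / real N * real (card {i \<in> {1..N}. sing_val (W N \<omega>) i > \<epsilon>})\<bar>"
      using pos by eventually_elim (simp add: eq)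
  qed
  have limit: "conv_prob M (\<lambda>N \<omega>. sing_val (W N \<omega>) i) \<sigma>bar sequentially"
    if "conv_prob M (\<lambda>N \<omega>. sing_val (S N \<omega>) i) \<sigma>bar sequentially" for i \<sigma>bar
    \<comment> \<open>Centring at the limit, because domination is available for limit 0.\<close>
    unfolding conv_prob_minus_limit[of M _ \<sigma>bar]
  proof (rule conv_prob_le[OF prob])
    have "conv_prob M (\<lambda>N \<omega>. \<bar>sing_val (S N \<omega>) i - \<sigma>bar\<bar>) 0 sequentially"
      using that conv_prob_abs conv_prob_minus_limit by blast
    then show "conv_prob M (\<lambda>N \<omega>. \<bar>sing_val (W N \<omega>) i - sing_val (S N \<omega>) i\<bar> + \<bar>sing_val (S N \<omega>) i - \<sigma>bar\<bar>)
        0 sequentially"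
      by (intro conv_prob_add prob diff)
    show "\<forall>\<^sub>F N in sequentially. (\<lambda>\<omega>. sing_val (W N \<omega>) i - \<sigma>bar) \<in> borel_measurable (M N)"
      using pos by eventually_elim measurable
  qed (intro always_eventually allI ballI, linarith)
  show ?thesis using op diff tail count empirical limit by blast
qed

end
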